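(* Let $F=\sum_{i=1}^M\alpha_i[X_i]$ be a homogeneous bracket polynomial, where $\alpha_i\in\mathbb K$ and the $X_i$ are Young tableaux of the same degree $d$ and of dimension $n$. Consider the following algorithm with input $F$: set $q:=\sum_{i=1}^M\alpha_i\,SB([X_i])$ and $g:=0$; while $q\neq0$, do $L:=LC(q)\,LM(q)$, $q:=q-LC(q)\,SB(LM(q))$, $g:=g+L$; when $q=0$, return $g$. This algorithm terminates after finitely many steps and returns the straight expression of $F$, i.e. the linear combination $g$ of straight bracket monomials that equals $F$ in the bracket algebra.
   Context: Let $\mathbb K$ be a field with $\mathrm{char}(\mathbb K)\ne2$, $m\ge n$, and let $\mathbf a_i=(x_{i1},\dots,x_{in})^T$, $i=1,\dots,m$, be vectors whose coordinates are variables of $\mathbb K[x_{ij}]$, ordered by $\mathbf a_1\prec\cdots\prec\mathbf a_m$. A Young tableau of degree $d$ and dimension $n$ is a $d\times n$ array with entries in $\{\mathbf a_1,\dots,\mathbf a_m\}$. It is straight if every row is strictly increasing from left to right and every column is nondecreasing downward. The bracket monomial $[Y]$ is the product of the brackets $[\mathbf y_{i1}\cdots\mathbf y_{in}]$ formed by the rows of $Y$; it is straight if $Y$ is straight. The bracket algebra is the polynomial ring in the brackets modulo the syzygy ideal, i.e. the ideal of all polynomials in the brackets that vanish when each bracket is replaced by the determinant $\det(\mathbf a_{i_1},\dots,\mathbf a_{i_n})$. Straight bracket monomials form a basis of the bracket algebra as a vector space, so every bracket polynomial has a unique straight expression. For a row $\mathbf R=(\mathbf r_1,\dots,\mathbf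 r_n)$ and $\sigma\in S_n$ put $\sigma(\mathbf R)=(\mathbf r_{\sigma(1)},\dots,\mathbf r_{\sigma(n)})$. If $Y$ has rows $\mathbf R_1,\dots,\mathbf R_d$, then $Y_{\sigma_1,\dots,\sigma_d}$ is the tableau with rows $\sigma_i(\mathbf R_i)$. The column normalization $\mathfrak N_C(T)$ of a tableau $T$ is obtained by sorting each column of $T$ nondecreasingly downward and then permuting the columns so that they are in nondecreasing lexicographic order (compared from top to bottom) from left to right. If $\mathfrak N_C(T)$ is straight, its columns are distinct, so the permutation $\pi_T\in S_n$ of the columns used here is unique. The special bracket polynomial of $[Y]$ is the formal linear combination of straight bracket monomials $$SB([Y]):=\sum_{(\tau_2,\dots,\tau_d)}\mathrm{sign}(\tau_2)\cdots\mathrm{sign}(\tau_d)\,\mathrm{sign}(\pi_T)^d\,[\mathfrak N_C(T)],\qquad T=Y_{\mathrm{id},\tau_2,\dots,\tau_d},$$ summed over all $(\tau_2,\dots,\tau_d)\in S_n^{d-1}$ for which $\mathfrak N_C(T)$ is straight. Negative column order on straight bracket monomials of the same degree: $[F]\prec[G]$ if, with $j$ the first column in which the straight tableaux $F=(\mathbf f_{ij})$, $G=(\mathbf g_{ij})$ differ and $i$ the topmost row in which these columns differ, $\mathbf f_{ij}\succ\mathbf g_{ij}$. For a nonzero linear combination $q$ of straight bracket monomials, $LM(q)$ and $LC(q)$ are its largest monomial in this order and the coefficient of that monomial. *)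

theory Defs
  imports
    "HOL-Library.FuncSet"
    "HOL-Library.List_Lexorder"
    "HOL-Library.Poly_Mapping"
    "HOL-Library.While_Combinator"
    "HOL-Combinatorics.Permutations"
    "Jordan_Normal_Form.Determinant"
begin

section \<open>Tableaux\<close>

text \<open>
  The vector \<open>a_i\<close> is represented by its index \<open>i \<in> {1..m}\<close>, so that the order on the
  vectors is the order on \<^typ>\<open>nat\<close>.  A tableau is the list of its rows, and
  \<^const>\<open>List.transpose\<close> lists its columns.
\<close>

type_synonym tableau = "nat list list"

definition is_tableau :: "nat \<Rightarrow> nat \<Rightarrow> nat \<Rightarrow> tableau \<Rightarrow> bool" where
  "is_tableau m n d Y \<longleftrightarrow> length Y = d \<and> (\<forall>R \<in> set Y. length R = n \<and> set R \<subseteq> {1..m})"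

definition straight :: "tableau \<Rightarrow> bool" where
  "straight Y \<longleftrightarrow>
     (\<forall>R \<in> set Y. sorted_wrt (<) R) \<and> (\<forall>C \<in> set (List.transpose Y). sorted C)"

definition permute_rows :: "(nat \<Rightarrow> nat \<Rightarrow> nat) \<Rightarrow> tableau \<Rightarrow> tableau" where
  "permute_rows \<sigma> Y = map (\<lambda>i. permute_list (\<sigma> i) (Y ! i)) [0..<length Y]"

definition sorted_columns :: "tableau \<Rightarrow> nat list list" where
  "sorted_columns T = map sort (List.transpose T)"

text \<open>The outer \<^const>\<open>sort\<close> refers to the lexicographic order on lists.\<close>

definition column_normalization :: "tableau \<Rightarrow> tableau" where
  "column_normalization T = List.transpose (sort (sorted_columns T))"

text \<open>Well defined only if the sorted columns are distinct.\<close>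

definition column_perm :: "tableau \<Rightarrow> nat \<Rightarrow> nat" where
  "column_perm T = (THE \<pi>. \<pi> permutes {..<length (sorted_columns T)} \<and>
     permute_list \<pi> (sorted_columns T) = sort (sorted_columns T))"

definition neg_column_less :: "tableau \<Rightarrow> tableau \<Rightarrow> bool" where
  "neg_column_less F G \<longleftrightarrow>
     (\<exists>i j. i < length F \<and> j < length (F ! i) \<and>
        (\<forall>j' < j. \<forall>i' < length F. F ! i' ! j' = G ! i' ! j') \<and>
        (\<forall>i' < i. F ! i' ! j = G ! i' ! j) \<and>
        F ! i ! j > G ! i ! j)"


section \<open>Bracket polynomials\<close>

text \<open>
  Polynomials over \<^typ>\<open>'a\<close> in variables of type \<^typ>\<open>'v\<close>: finitely supported maps from
  monomials (exponent maps) to coefficients, with the convolution product.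
\<close>

type_synonym ('v, 'a) mpoly = "('v \<Rightarrow>\<^sub>0 nat) \<Rightarrow>\<^sub>0 'a"

definition Const :: "'a::zero \<Rightarrow> ('v, 'a) mpoly" where
  "Const c = Poly_Mapping.single 0 c"

definition Var :: "'v \<Rightarrow> ('v, 'a::zero_neq_one) mpoly" where
  "Var v = Poly_Mapping.single (Poly_Mapping.single v 1) 1"

text \<open>
  The variables of bracket polynomials are the formal brackets \<open>[y_1 \<dots> y_n]\<close>, one for each
  \<open>n\<close>-tuple of vectors; antisymmetry and repeated entries are accounted for by the syzygy ideal.
\<close>

definition brackets :: "nat \<Rightarrow> nat \<Rightarrow> nat list set" where
  "brackets m n = {R. length R = n \<and> set R \<subseteq> {1..m}}"

definition bracket_polys :: "nat \<Rightarrow> nat \<Rightarrow> (nat list, 'a::zero) mpoly set" where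
  "bracket_polys m n =
     {p. \<forall>\<mu> \<in> Poly_Mapping.keys p. Poly_Mapping.keys \<mu> \<subseteq> brackets m n}"

text \<open>The variable \<open>(i, k)\<close> is the coordinate \<open>x_ik\<close>; matrix indices start at 0.\<close>

definition bracket_det :: "nat \<Rightarrow> nat list \<Rightarrow> (nat \<times> nat, 'a::comm_ring_1) mpoly" where
  "bracket_det n R = det (mat n n (\<lambda>(k, j). Var (R ! j, Suc k)))"

definition substitute_dets ::
    "nat \<Rightarrow> (nat list, 'a::comm_ring_1) mpoly \<Rightarrow> (nat \<times> nat, 'a) mpoly" where
  "substitute_dets n p =
     (\<Sum>\<mu> \<in> Poly_Mapping.keys p. Const (Poly_Mapping.lookup p \<mu>) *
        (\<Prod>R \<in> Poly_Mapping.keys \<mu>. bracket_det n R ^ Poly_Mapping.lookup \<mu> R))"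

definition syzygy_ideal :: "nat \<Rightarrow> nat \<Rightarrow> (nat list, 'a::comm_ring_1) mpoly set" where
  "syzygy_ideal m n = {p \<in> bracket_polys m n. substitute_dets n p = 0}"

definition equal_in_bracket_algebra ::
    "nat \<Rightarrow> nat \<Rightarrow> (nat list, 'a::comm_ring_1) mpoly \<Rightarrow> (nat list, 'a) mpoly \<Rightarrow> bool" where
  "equal_in_bracket_algebra m n p q \<longleftrightarrow> p - q \<in> syzygy_ideal m n"

definition bracket_monomial :: "tableau \<Rightarrow> (nat list, 'a::comm_ring_1) mpoly" where
  "bracket_monomial Y = (\<Prod>R\<leftarrow>Y. Var R)"


section \<open>Linear combinations of straight bracket monomials\<close>

text \<open>
  A formal linear combination of bracket monomials \<open>[Y]\<close>, \<open>Y\<close> straight, is a finitely supported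
  map on tableaux.  A straight tableau is determined by its bracket monomial, since its rows form
  a chain for the componentwise order.
\<close>

definition bracket_poly_of :: "(tableau \<Rightarrow>\<^sub>0 'a::comm_ring_1) \<Rightarrow> (nat list, 'a) mpoly" where
  "bracket_poly_of g =
     (\<Sum>Y \<in> Poly_Mapping.keys g. Const (Poly_Mapping.lookup g Y) * bracket_monomial Y)"

definition is_straight_expression ::
    "nat \<Rightarrow> nat \<Rightarrow> (nat list, 'a::comm_ring_1) mpoly \<Rightarrow> (tableau \<Rightarrow>\<^sub>0 'a) \<Rightarrow> bool" where
  "is_straight_expression m n F g \<longleftrightarrow>
     (\<forall>Y \<in> Poly_Mapping.keys g. is_tableau m n (length Y) Y \<and> straight Y) \<and>
     equal_in_bracket_algebra m n (bracket_poly_of g) F"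

definition scale :: "'a::mult_zero \<Rightarrow> ('b \<Rightarrow>\<^sub>0 'a) \<Rightarrow> ('b \<Rightarrow>\<^sub>0 'a)" where
  "scale c q = Poly_Mapping.map ((*) c) q"

definition LM :: "(tableau \<Rightarrow>\<^sub>0 'a::zero) \<Rightarrow> tableau" where
  "LM q = (THE F. F \<in> Poly_Mapping.keys q \<and>
     (\<forall>G \<in> Poly_Mapping.keys q. G \<noteq> F \<longrightarrow> neg_column_less G F))"

definition LC :: "(tableau \<Rightarrow>\<^sub>0 'a::zero) \<Rightarrow> 'a" where
  "LC q = Poly_Mapping.lookup q (LM q)"


section \<open>Special bracket polynomials and the algorithm\<close>

text \<open>Families \<open>(id, \<tau>_2, \<dots>, \<tau>_d)\<close> of permutations of the \<open>n\<close> positions, indexed from 0.\<close>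

definition row_perms :: "nat \<Rightarrow> nat \<Rightarrow> (nat \<Rightarrow> nat \<Rightarrow> nat) set" where
  "row_perms n d = (\<Pi>\<^sub>E i \<in> {..<d}. if i = 0 then {id} else {\<tau>. \<tau> permutes {..<n}})"

definition SB :: "nat \<Rightarrow> tableau \<Rightarrow> (tableau \<Rightarrow>\<^sub>0 'a::comm_ring_1)" where
  "SB n Y =
     (\<Sum>\<tau> \<in> {\<tau> \<in> row_perms n (length Y). straight (column_normalization (permute_rows \<tau> Y))}.
        let T = permute_rows \<tau> Y in
        Poly_Mapping.single (column_normalization T)
          (of_int ((\<Prod>i = 1..<length Y. sign (\<tau> i)) * sign (column_perm T) ^ length Y)))"

text \<open>
  The input is the expression \<open>\<Sum>i = 1..M. \<alpha> i [X i]\<close>, the loop state is \<open>(q, g)\<close>, and the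
  result is \<^const>\<open>None\<close> iff the loop does not terminate.
\<close>

definition straightening_algorithm ::
    "nat \<Rightarrow> nat \<Rightarrow> (nat \<Rightarrow> 'a::comm_ring_1) \<Rightarrow> (nat \<Rightarrow> tableau) \<Rightarrow> (tableau \<Rightarrow>\<^sub>0 'a) option" where
  "straightening_algorithm n M \<alpha> X =
     map_option snd (while_option
       (\<lambda>(q, g). q \<noteq> 0)
       (\<lambda>(q, g). (q - scale (LC q) (SB n (LM q)), g + Poly_Mapping.single (LM q) (LC q)))
       (\<Sum>i = 1..M. scale (\<alpha> i) (SB n (X i)), 0))"

end

theory Submission
  imports Defs
begin

text \<open>
The proof rests on one observation: the coefficient of a straight monomial \<open>[N]\<close> in
\<open>SB([Y])\<close> is the coefficient of a single monomial in the coordinates in the product of the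
determinants of the rows of \<open>Y\<close>.  Expanding these determinants by the Leibniz formula gives
one signed monomial for each rearrangement of the rows of \<open>Y\<close>, and this monomial
(\<open>content_monomial\<close>) records the multiset of entries of each column of the rearranged
tableau.  Collecting the rearrangements whose columns have the contents of the columns of
\<open>N\<close>, and normalizing the first row by a common permutation of all columns, gives exactly
the sum that defines \<open>SB\<close> (\<open>lookup_SB\<close>).  Hence \<open>SB\<close> depends only on the image of a bracket
polynomial in the bracket algebra.

On straight tableaux the coefficients are unitriangular for the negative column order: the
coefficient of the content of \<open>S\<close> in the determinant product of \<open>S\<close> is 1, and it is nonzero for
another straight tableau \<open>Y\<close> only if \<open>S\<close> is smaller than \<open>Y\<close> (\<open>straight_content_cases\<close>).
Column by column, the entries of any rearrangement of the rows of \<open>Y\<close> dominate those of \<open>Y\<close>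
as long as the earlier columns are untouched.  Two things follow.  Straight monomials are
linearly independent (\<open>straight_combination_zero\<close>), which gives uniqueness.  And every step
of the algorithm replaces the largest monomial of \<open>q\<close> by smaller ones, so it stops, with a
result \<open>g\<close> for which \<open>SB(g) = SB(F)\<close> (\<open>straightening_algorithm_terminates\<close>).

It remains to see that \<open>SB(g) = SB(F)\<close> forces \<open>g = F\<close> in the bracket algebra, and here one needs
that straight monomials span.  Over the rationals this is the straightening law
(\<open>tableau_det_in_straight_span\<close>): at a violation of straightness in two adjacent rows, \<open>n + 1\<close>
entries taken from the two rows are antisymmetrized, the result vanishes because the entries
are vectors in an \<open>n\<close>-dimensional space, and solving for the original product expresses it by
tableaux of smaller weight.  Solving involves a division, so this argument alone does not work
over a field of positive characteristic.  But the algorithm makes sense over the integers,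
where it produces an integral straight expression; by linear independence over the rationals it
agrees with the rational one (\<open>integral_straightening\<close>).  All coefficients of products of
determinants being images of integers, the integral identity specializes to every field.
\<close>

section \<open>Tableaux and their columns\<close>

text \<open>
Columns are indexed from 0; \<^const>\<open>List.transpose\<close> lists them only for a nonempty tableau, since a
tableau without rows does not remember its dimension.
\<close>

definition column :: "nat \<Rightarrow> tableau \<Rightarrow> nat list" where
  "column k T = map (\<lambda>R. R ! k) T"

lemma length_column [simp]: "length (column k T) = length T"
  by (simp add: column_def)

lemma nth_column [simp]: "i < length T \<Longrightarrow> column k T ! i = T ! i ! k"
  by (simp add: column_def)

lemma is_tableau_length: "is_tableau m n d T \<Longrightarrow> length T = d"
  by (simp add: is_tableau_def)

lemma is_tableau_row: "is_tableau m n d T \<Longrightarrow> i < d \<Longrightarrow> length (T ! i) = n"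
  by (auto simp: is_tableau_def)

lemma finite_tableaux: "finite {T. is_tableau m n d T}"
proof -
  have "{T. is_tableau m n d T} \<subseteq> {T. set T \<subseteq> {R. set R \<subseteq> {1..m} \<and> length R = n} \<and> length T = d}"
    by (auto simp: is_tableau_def)
  then show ?thesis
    by (rule finite_subset) (intro finite_lists_length_eq, auto)
qed

lemma transpose_tableau:
  assumes "is_tableau m n d T" "1 \<le> d"
  shows "List.transpose T = map (\<lambda>k. column k T) [0..<n]"
proof -
  have "List.transpose T = map (\<lambda>i. map (\<lambda>j. T ! j ! i) [0..<length T]) [0..<n]"
    using assms by (intro transpose_rectangle) (auto simp: is_tableau_def)
  also have "\<dots> = map (\<lambda>k. column k T) [0..<n]"
    by (intro map_cong refl nth_equalityI) auto
  finally show ?thesis .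
qed

lemma tableau_eqI:
  assumes "is_tableau m n d S" "is_tableau m n d T" "\<And>k. k < n \<Longrightarrow> column k S = column k T"
  shows "S = T"
proof (rule nth_equalityI)
  show len: "length S = length T"
    using assms by (simp add: is_tableau_length)
  fix i assume i: "i < length S"
  show "S ! i = T ! i"
  proof (rule nth_equalityI)
    show "length (S ! i) = length (T ! i)"
      using assms i len by (simp add: is_tableau_length is_tableau_row)
    fix k assume "k < length (S ! i)"
    then have "k < n" using assms i len by (simp add: is_tableau_length is_tableau_row)
    from assms(3)[OF this] show "S ! i ! k = T ! i ! k"
      using i len by (metis nth_column)
  qed
qed

lemma straight_tableau_iff:
  assumes "is_tableau m n d T" "1 \<le> d"
  shows "straight T \<longleftrightarrow>
    (\<forall>R \<in> set T. sorted_wrt (<) R) \<and> (\<forall>k < n. sorted (column k T))"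
  unfolding straight_def transpose_tableau[OF assms] by auto

lemma straight_row_less:
  assumes "is_tableau m n d T" "straight T" "i < d" "j < k" "k < n"
  shows "T ! i ! j < T ! i ! k"
  using assms by (auto simp: straight_def is_tableau_def sorted_wrt_iff_nth_less)

lemma straight_column_sorted:
  assumes "is_tableau m n d T" "1 \<le> d" "straight T" "k < n"
  shows "sorted (column k T)"
  using assms straight_tableau_iff by blast

lemma list_less_iff_first_difference:
  fixes xs ys :: "'b::linorder list"
  assumes "length xs = length ys"
  shows "xs < ys \<longleftrightarrow> (\<exists>i < length xs. (\<forall>i' < i. xs ! i' = ys ! i') \<and> xs ! i < ys ! i)"
proof -
  have take_eq: "take i xs = take i ys \<longleftrightarrow> (\<forall>i' < i. xs ! i' = ys ! i')" if "i < length xs" for i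
    using that assms nth_take_lemma[of i xs ys] by (metis less_imp_le nth_take)
  have "xs < ys \<longleftrightarrow> (\<exists>i < length xs. take i xs = take i ys \<and> xs ! i < ys ! i)"
    unfolding list_less_def lexord_take_index_conv using assms by simp
  also have "\<dots> \<longleftrightarrow> (\<exists>i < length xs. (\<forall>i' < i. xs ! i' = ys ! i') \<and> xs ! i < ys ! i)"
    using take_eq by (intro ex_cong1) blast
  finally show ?thesis .
qed

text \<open>
Linearity of the order on tableaux of one shape comes from here: the comparison at the first
differing entry is two nested lexicographic comparisons, first of columns and then of entries.
\<close>

lemma neg_column_less_iff:
  assumes "is_tableau m n d F" "is_tableau m n d G" "1 \<le> d"
  shows "neg_column_less F G \<longleftrightarrow> List.transpose G < List.transpose F"
proof -
  have len: "length F = d" "length G = d"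
    using assms by (auto simp: is_tableau_def)
  have row: "i < d \<Longrightarrow> length (F ! i) = n" for i
    using assms by (auto simp: is_tableau_row)
  have "List.transpose G < List.transpose F \<longleftrightarrow>
    (\<exists>j < n. (\<forall>j' < j. column j' G = column j' F) \<and> column j G < column j F)"
    unfolding transpose_tableau[OF assms(1,3)] transpose_tableau[OF assms(2,3)]
    by (subst list_less_iff_first_difference) auto
  also have "\<dots> \<longleftrightarrow> (\<exists>j < n. (\<forall>j' < j. \<forall>i' < d. F ! i' ! j' = G ! i' ! j') \<and>
      (\<exists>i < d. (\<forall>i' < i. F ! i' ! j = G ! i' ! j) \<and> G ! i ! j < F ! i ! j))"
  proof -
    have "column j G = column j F \<longleftrightarrow> (\<forall>i < d. F ! i ! j = G ! i ! j)" for j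
      unfolding list_eq_iff_nth_eq using len by auto
    moreover have "column j G < column j F \<longleftrightarrow>
        (\<exists>i < d. (\<forall>i' < i. F ! i' ! j = G ! i' ! j) \<and> G ! i ! j < F ! i ! j)" for j
      by (subst list_less_iff_first_difference) (use len in \<open>auto intro!: ex_cong1\<close>)
    ultimately show ?thesis by simp
  qed
  also have "\<dots> \<longleftrightarrow> neg_column_less F G" (is "?L \<longleftrightarrow> _")
  proof
    assume ?L
    then show "neg_column_less F G"
      unfolding neg_column_less_def len using row by blast
  next
    assume "neg_column_less F G"
    then obtain i j where "i < d" "j < length (F ! i)" "\<forall>j' < j. \<forall>i' < d. F ! i' ! j' = G ! i' ! j'"
      "\<forall>i' < i. F ! i' ! j = G ! i' ! j" "F ! i ! j > G ! i ! j"
      unfolding neg_column_less_def len by blast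
    moreover from this row have "j < n" by simp
    ultimately show ?L by blast
  qed
  finally show ?thesis by simp
qed

lemma transpose_tableau_inj:
  assumes "is_tableau m n d F" "is_tableau m n d G" "1 \<le> d" "List.transpose F = List.transpose G"
  shows "F = G"
proof (rule tableau_eqI[OF assms(1,2)])
  fix k assume "k < n"
  with assms(4) show "column k F = column k G"
    unfolding transpose_tableau[OF assms(1,3)] transpose_tableau[OF assms(2,3)] map_eq_conv by simp
qed

section \<open>Contents of tableaux\<close>

text \<open>
The exponent of the monomial \<open>\<Prod> x_vk\<close>, over all entries \<open>v\<close> of \<open>T\<close> and their columns \<open>k\<close>.  Its
variables are numbered as in \<^const>\<open>bracket_det\<close>, so column \<open>k\<close> belongs to coordinate \<open>Suc k\<close>.
\<close>

definition content_monomial :: "nat \<Rightarrow> tableau \<Rightarrow> (nat \<times> nat \<Rightarrow>\<^sub>0 nat)" where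
  "content_monomial n T = (\<Sum>R\<leftarrow>T. \<Sum>k<n. Poly_Mapping.single (R ! k, Suc k) 1)"

lemma lookup_content_monomial:
  "Poly_Mapping.lookup (content_monomial n T) (v, k) =
     (if 1 \<le> k \<and> k \<le> n then count (mset (column (k - 1) T)) v else 0)"
proof (induction T)
  case Nil
  then show ?case by (simp add: content_monomial_def column_def)
next
  case (Cons R T)
  have "Poly_Mapping.lookup (\<Sum>j<n. Poly_Mapping.single (R ! j, Suc j) (1::nat)) (v, k) =
      (\<Sum>j<n. if j = k - 1 \<and> 1 \<le> k \<and> R ! (k - 1) = v then 1 else 0)"
    unfolding lookup_sum by (intro sum.cong) (auto simp: lookup_single when_def)
  also have "\<dots> = (if 1 \<le> k \<and> k \<le> n \<and> R ! (k - 1) = v then 1 else 0)"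
    by (cases "1 \<le> k \<and> R ! (k - 1) = v") (auto simp: sum.delta)
  finally show ?case using Cons by (auto simp: content_monomial_def column_def lookup_add)
qed

lemma content_monomial_eq_iff:
  "content_monomial n S = content_monomial n T \<longleftrightarrow> (\<forall>k < n. mset (column k S) = mset (column k T))"
proof
  assume eq: "content_monomial n S = content_monomial n T"
  show "\<forall>k < n. mset (column k S) = mset (column k T)"
  proof (intro allI impI multiset_eqI)
    fix k v assume "k < n"
    with eq show "count (mset (column k S)) v = count (mset (column k T)) v"
      using lookup_content_monomial[of n S v "Suc k"] lookup_content_monomial[of n T v "Suc k"] by simp
  qed
next
  assume *: "\<forall>k < n. mset (column k S) = mset (column k T)"
  show "content_monomial n S = content_monomial n T"
    by (rule poly_mapping_eqI, clarify) (use * in \<open>auto simp: lookup_content_monomial\<close>)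
qed

section \<open>Coefficients of products of determinants\<close>

text \<open>
In contrast to \<^const>\<open>row_perms\<close>, the first row is permuted as well: these families index the
full Leibniz expansion of a product of determinants.
\<close>

definition all_row_perms :: "nat \<Rightarrow> nat \<Rightarrow> (nat \<Rightarrow> nat \<Rightarrow> nat) set" where
  "all_row_perms n d = (\<Pi>\<^sub>E i \<in> {..<d}. {\<sigma>. \<sigma> permutes {..<n}})"

text \<open>
The coefficient of the monomial \<open>\<mu>\<close> in the product of the determinants of the rows of \<open>Y\<close>.  It is
kept as an integer so that it can be used over every coefficient ring.
\<close>

definition det_coeff :: "nat \<Rightarrow> (nat \<times> nat \<Rightarrow>\<^sub>0 nat) \<Rightarrow> tableau \<Rightarrow> int" where
  "det_coeff n \<mu> Y = (\<Sum>\<sigma> | \<sigma> \<in> all_row_perms n (length Y) \<and> content_monomial n (permute_rows \<sigma> Y) = \<mu>.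
     \<Prod>i<length Y. sign (\<sigma> i))"

definition tableau_det :: "nat \<Rightarrow> tableau \<Rightarrow> (nat \<times> nat, 'a::comm_ring_1) mpoly" where
  "tableau_det n Y = (\<Prod>R\<leftarrow>Y. bracket_det n R)"

lemma finite_all_row_perms [simp]: "finite (all_row_perms n d)"
  unfolding all_row_perms_def by (intro finite_PiE) (auto intro: finite_permutations)

lemma prod_single_one:
  "finite A \<Longrightarrow> (\<Prod>k\<in>A. Poly_Mapping.single (f k) (1::'a::comm_ring_1)) =
     Poly_Mapping.single (\<Sum>k\<in>A. f k) 1"
  by (induction A rule: finite_induct) (auto simp: mult_single)

lemma permute_rows_row:
  assumes "is_tableau m n d Y" "\<sigma> \<in> all_row_perms n d" "i < d" "k < n"
  shows "permute_rows \<sigma> Y ! i ! k = Y ! i ! (\<sigma> i k)"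
  using assms
  by (auto simp: permute_rows_def is_tableau_length is_tableau_row all_row_perms_def permute_list_def)

lemma length_permute_rows [simp]: "length (permute_rows \<sigma> Y) = length Y"
  by (simp add: permute_rows_def)

lemma content_monomial_conv_sum:
  "content_monomial n T = (\<Sum>i<length T. \<Sum>k<n. Poly_Mapping.single (T ! i ! k, Suc k) 1)"
  by (simp add: content_monomial_def sum_list_sum_nth atLeast0LessThan)

lemma bracket_det_conv_rows:
  "(bracket_det n R :: (_, 'a::comm_ring_1) mpoly) = (\<Sum>p | p permutes {..<n}. of_int (sign p) *
     (\<Prod>k<n. Var (R ! p k, Suc k)))"
proof -
  have "(\<Prod>k<n. mat n n (\<lambda>(k, j). Var (R ! j, Suc k)) $$ (k, p k)) =
      (\<Prod>k<n. (Var (R ! p k, Suc k) :: (_, 'a) mpoly))" if "p permutes {..<n}" for p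
    by (intro prod.cong refl) (use permutes_in_image[OF that] in simp)
  then show ?thesis
    unfolding bracket_det_def det_def'[OF mat_carrier] atLeast0LessThan
    by (intro sum.cong refl arg_cong2[of _ _ _ _ "(*)"]) simp
qed

lemma bracket_det_conv_columns:
  "(bracket_det n R :: (_, 'a::comm_ring_1) mpoly) = (\<Sum>p | p permutes {..<n}. of_int (sign p) *
     (\<Prod>j<n. Var (R ! j, Suc (p j))))"
proof -
  have "(\<Prod>k<n. mat n n (\<lambda>(k, j). Var (R ! j, Suc k)) $$ (p k, k)) =
      (\<Prod>k<n. (Var (R ! k, Suc (p k)) :: (_, 'a) mpoly))" if "p permutes {..<n}" for p
    by (intro prod.cong refl) (use permutes_in_image[OF that] in simp)
  then show ?thesis
    unfolding bracket_det_def det_col[OF mat_carrier] atLeast0LessThan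
    by (intro sum.cong refl arg_cong2[of _ _ _ _ "(*)"]) simp
qed

lemma lookup_of_int_mult:
  "Poly_Mapping.lookup (of_int c * p) \<mu> = of_int c * Poly_Mapping.lookup p \<mu>"
  for p :: "('b::comm_monoid_add) \<Rightarrow>\<^sub>0 ('a::comm_ring_1)"
  unfolding single_of_int[symmetric] mult_map_scale_conv_mult[symmetric]
  by (simp add: Poly_Mapping.map.rep_eq when_def)

lemma prod_list_conv_prod: "(\<Prod>x\<leftarrow>xs. f x) = (\<Prod>i<length xs. f (xs ! i))"
  for f :: "'b \<Rightarrow> 'c::comm_monoid_mult"
  by (induction xs rule: rev_induct) (auto simp: nth_append mult.commute intro!: arg_cong2[of _ _ _ _ "(*)"] prod.cong)

text \<open>
Each determinant is a signed sum over the permutations of one row.  Multiplying out gives one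
monomial for each family of row permutations, namely the content of the permuted tableau.
\<close>

lemma lookup_tableau_det:
  assumes "is_tableau m n d Y"
  shows "Poly_Mapping.lookup (tableau_det n Y :: (_, 'a::comm_ring_1) mpoly) \<mu> =
    of_int (det_coeff n \<mu> Y)"
proof -
  have len: "length Y = d" using assms by (rule is_tableau_length)
  have "(tableau_det n Y :: (_, 'a) mpoly) = (\<Prod>i<d. bracket_det n (Y ! i))"
    by (simp add: tableau_det_def prod_list_conv_prod len)
  also have "\<dots> = (\<Prod>i<d. \<Sum>p | p permutes {..<n}. of_int (sign p) *
      Poly_Mapping.single (\<Sum>k<n. Poly_Mapping.single (Y ! i ! p k, Suc k) 1) 1)"
    by (simp add: bracket_det_conv_rows Var_def prod_single_one)
  also have "\<dots> = (\<Sum>\<sigma>\<in>all_row_perms n d. \<Prod>i<d. of_int (sign (\<sigma> i)) *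
      Poly_Mapping.single (\<Sum>k<n. Poly_Mapping.single (Y ! i ! \<sigma> i k, Suc k) 1) 1)"
    unfolding all_row_perms_def by (rule prod_sum_PiE) (auto intro: finite_permutations)
  also have "\<dots> = (\<Sum>\<sigma>\<in>all_row_perms n d. of_int (\<Prod>i<d. sign (\<sigma> i)) *
      Poly_Mapping.single (content_monomial n (permute_rows \<sigma> Y)) 1)"
  proof (intro sum.cong refl)
    fix \<sigma> assume \<sigma>: "\<sigma> \<in> all_row_perms n d"
    have "content_monomial n (permute_rows \<sigma> Y) =
        (\<Sum>i<d. \<Sum>k<n. Poly_Mapping.single (Y ! i ! \<sigma> i k, Suc k) 1)"
      by (simp add: content_monomial_conv_sum len permute_rows_row[OF assms \<sigma>])
    then show "(\<Prod>i<d. of_int (sign (\<sigma> i)) *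
      Poly_Mapping.single (\<Sum>k<n. Poly_Mapping.single (Y ! i ! \<sigma> i k, Suc k) 1) 1) =
      of_int (\<Prod>i<d. sign (\<sigma> i)) * (Poly_Mapping.single (content_monomial n (permute_rows \<sigma> Y)) 1 :: (_, 'a) mpoly)"
      by (simp add: prod.distrib prod_single_one)
  qed
  finally have "Poly_Mapping.lookup (tableau_det n Y :: (_, 'a) mpoly) \<mu> =
      (\<Sum>\<sigma>\<in>all_row_perms n d. if content_monomial n (permute_rows \<sigma> Y) = \<mu> then of_int (\<Prod>i<d. sign (\<sigma> i)) else 0)"
    by (simp add: lookup_sum lookup_of_int_mult lookup_single when_def if_distrib cong: if_cong
             del: of_int_prod)
  also have "\<dots> = of_int (det_coeff n \<mu> Y)"
    by (simp add: det_coeff_def len sum.If_cases Int_def flip: of_int_sum of_int_prod)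
  finally show ?thesis .
qed

section \<open>Leading monomials of straight tableaux\<close>

lemma list_all2_insort:
  fixes a b :: "'b::linorder"
  assumes "list_all2 (\<le>) xs ys" "a \<le> b" "sorted xs" "sorted ys"
  shows "list_all2 (\<le>) (insort a xs) (insort b ys)"
  using assms
proof (induction xs ys arbitrary: a b rule: list_all2_induct)
  case (Cons x xs y ys)
  consider "a \<le> x" "b \<le> y" | "a \<le> x" "\<not> b \<le> y" | "\<not> a \<le> x" "b \<le> y" |
    "\<not> a \<le> x" "\<not> b \<le> y" by blast
  then show ?case
  proof cases
    case 2
    then have "list_all2 (\<le>) (insort x xs) (insort b ys)"
      using Cons by (intro Cons.IH) auto
    moreover have "insort x xs = x # xs"
      using Cons.prems by (cases xs) auto
    ultimately show ?thesis using 2 Cons.hyps by auto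
  next
    case 3
    then have "list_all2 (\<le>) (insort a xs) (insort y ys)"
      using Cons by (intro Cons.IH) auto
    moreover have "insort y ys = y # ys"
      using Cons.prems by (cases ys) auto
    ultimately show ?thesis using 3 Cons.prems by auto
  next
    case 4
    then have "list_all2 (\<le>) (insort a xs) (insort b ys)"
      using Cons by (intro Cons.IH) auto
    then show ?thesis using 4 Cons.hyps by simp
  qed (use Cons in simp)
qed auto

lemma list_all2_sort:
  fixes xs ys :: "'b::linorder list"
  shows "list_all2 (\<le>) xs ys \<Longrightarrow> list_all2 (\<le>) (sort xs) (sort ys)"
  by (induction rule: list_all2_induct) (auto intro: list_all2_insort)

lemma all_row_perms_permutes: "\<sigma> \<in> all_row_perms n d \<Longrightarrow> i < d \<Longrightarrow> \<sigma> i permutes {..<n}"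
  by (auto simp: all_row_perms_def)

lemma is_tableau_permute_rows:
  assumes "is_tableau m n d Y" "\<sigma> \<in> all_row_perms n d"
  shows "is_tableau m n d (permute_rows \<sigma> Y)"
proof -
  have "length (permute_list (\<sigma> i) (Y ! i)) = n \<and> set (permute_list (\<sigma> i) (Y ! i)) \<subseteq> {1..m}"
    if i: "i < d" for i
  proof -
    have "\<sigma> i permutes {..<length (Y ! i)}"
      using all_row_perms_permutes[OF assms(2) i] is_tableau_row[OF assms(1) i] by simp
    moreover have "Y ! i \<in> set Y" using assms(1) i by (simp add: is_tableau_def)
    ultimately show ?thesis using assms(1) by (simp add: is_tableau_def)
  qed
  then show ?thesis using assms(1) by (auto simp: is_tableau_def permute_rows_def)
qed

text \<open>
If the permutations fix the first \<open>j\<close> positions of every row, then position \<open>j\<close> receives entries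
from positions at or after \<open>j\<close>, which are no smaller because rows increase.  Sorting preserves
this domination, and if the sorted columns agree, then so do the sums of their entries, so no
entry has moved at all.
\<close>

lemma fixed_prefix_dominates:
  assumes Y: "is_tableau m n d Y" "straight Y" and S: "is_tableau m n d S" "straight S"
    and "1 \<le> d" and \<sigma>: "\<sigma> \<in> all_row_perms n d"
    and content: "content_monomial n (permute_rows \<sigma> Y) = content_monomial n S"
    and fixed: "\<And>i k. i < d \<Longrightarrow> k < j \<Longrightarrow> \<sigma> i k = k" and "j < n"
  shows "\<And>i. i < d \<Longrightarrow> Y ! i ! j \<le> S ! i ! j"
    and "column j S = column j Y \<Longrightarrow> i < d \<Longrightarrow> \<sigma> i j = j"
proof -
  define T where "T = permute_rows \<sigma> Y"
  have len: "length T = d" "length Y = d" "length S = d"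
    using Y S by (auto simp: T_def is_tableau_length)
  have ge: "j \<le> \<sigma> i j" "\<sigma> i j < n" if "i < d" for i
  proof -
    have perm: "\<sigma> i permutes {..<n}" using \<sigma> that by (rule all_row_perms_permutes)
    show "\<sigma> i j < n" using permutes_in_image[OF perm] \<open>j < n\<close> by simp
    show "j \<le> \<sigma> i j"
      using fixed[OF that, of "\<sigma> i j"] permutes_inj[OF perm] by (metis injD leI less_irrefl)
  qed
  have T_nth: "T ! i ! j = Y ! i ! (\<sigma> i j)" if "i < d" for i
    unfolding T_def using permute_rows_row[OF Y(1) \<sigma> that \<open>j < n\<close>] .
  have le: "Y ! i ! j \<le> T ! i ! j" if "i < d" for i
    using straight_row_less[OF Y that _ ge(2)[OF that], of j] ge[OF that] T_nth[OF that]
    by (cases "j = \<sigma> i j") auto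
  have "list_all2 (\<le>) (sort (column j Y)) (sort (column j T))"
    by (rule list_all2_sort) (simp add: list_all2_conv_all_nth len le)
  moreover have "sort (column j Y) = column j Y"
    using straight_column_sorted[OF Y(1) \<open>1 \<le> d\<close> Y(2) \<open>j < n\<close>] by (simp add: sorted_sort_id)
  moreover have mset: "mset (column j T) = mset (column j S)"
    using content \<open>j < n\<close> by (auto simp: content_monomial_eq_iff T_def)
  then have "sort (column j T) = column j S"
    using straight_column_sorted[OF S(1) \<open>1 \<le> d\<close> S(2) \<open>j < n\<close>] by (metis properties_for_sort)
  ultimately have dom: "list_all2 (\<le>) (column j Y) (column j S)" by simp
  show "Y ! i ! j \<le> S ! i ! j" if "i < d" for i
    using list_all2_nthD[OF dom, of i] that by (simp add: len)
  assume eq: "column j S = column j Y" and i: "i < d"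
  have "sum_list (column j Y) = sum_list (column j T)"
    using mset eq by (metis sum_mset_sum_list)
  then have "(\<Sum>i<d. Y ! i ! j) = (\<Sum>i<d. T ! i ! j)"
    by (simp add: sum_list_sum_nth atLeast0LessThan len)
  then have "Y ! i ! j = T ! i ! j"
    by (rule sum_mono_inv) (use le i in auto)
  then show "\<sigma> i j = j"
    using straight_row_less[OF Y i _ ge(2)[OF i], of j] ge[OF i] T_nth[OF i] by (metis le_neq_implies_less nat_less_le)
qed

text \<open>
Unitriangularity.  By induction on columns, the permutations are trivial up to the first column
in which \<open>S\<close> and \<open>Y\<close> differ, and there \<open>S\<close> dominates \<open>Y\<close>; larger entries mean a smaller tableau in
the negative column order.
\<close>

lemma straight_content_cases:
  assumes Y: "is_tableau m n d Y" "straight Y" and S: "is_tableau m n d S" "straight S"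
    and "1 \<le> d" and \<sigma>: "\<sigma> \<in> all_row_perms n d"
    and content: "content_monomial n (permute_rows \<sigma> Y) = content_monomial n S"
  shows "S = Y \<and> \<sigma> = (\<lambda>i\<in>{..<d}. id) \<or> neg_column_less S Y"
proof -
  have len: "length S = d" "length Y = d" using S Y by (auto simp: is_tableau_length)
  have fixed: "\<forall>i < d. \<forall>k < j. \<sigma> i k = k" if "j \<le> n" "\<forall>k < j. column k S = column k Y" for j
    using that
  proof (induction j)
    case (Suc j)
    then have "\<sigma> i j = j" if "i < d" for i
      using that by (intro fixed_prefix_dominates(2)[OF Y S \<open>1 \<le> d\<close> \<sigma> content, of j i]) auto
    with Suc show ?case by (auto simp: less_Suc_eq)
  qed simp
  show ?thesis
  proof (cases "\<forall>k < n. column k S = column k Y")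
    case True
    then have "S = Y" by (intro tableau_eqI[OF S(1) Y(1)]) auto
    moreover have "\<sigma> i k = (\<lambda>i\<in>{..<d}. id) i k" for i k
    proof (cases "i < d")
      case i: True
      have "\<sigma> i permutes {..<n}" using \<sigma> i by (rule all_row_perms_permutes)
      then show ?thesis
        using fixed[OF order_refl True] i by (cases "k < n") (auto simp: permutes_def)
    next
      case False
      then show ?thesis using \<sigma> by (auto simp: all_row_perms_def PiE_def extensional_def)
    qed
    ultimately show ?thesis by blast
  next
    case False
    define j where "j = (LEAST k. k < n \<and> column k S \<noteq> column k Y)"
    have j: "j < n" "column j S \<noteq> column j Y"
      using False LeastI_ex[of "\<lambda>k. k < n \<and> column k S \<noteq> column k Y"] unfolding j_def by auto
    have less_j: "column k S = column k Y" if "k < j" for k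
      using not_less_Least[OF that[unfolded j_def]] that j(1) by auto
    define i where "i = (LEAST i. i < d \<and> S ! i ! j \<noteq> Y ! i ! j)"
    have "\<exists>i. i < d \<and> S ! i ! j \<noteq> Y ! i ! j"
      using j(2) len by (metis length_column nth_column nth_equalityI)
    from LeastI_ex[OF this] have i: "i < d" "S ! i ! j \<noteq> Y ! i ! j" unfolding i_def by auto
    have less_i: "S ! i' ! j = Y ! i' ! j" if "i' < i" for i'
      using not_less_Least[OF that[unfolded i_def]] that i(1) by auto
    have "Y ! i ! j \<le> S ! i ! j"
      using fixed[of j] j(1) less_j i(1)
      by (intro fixed_prefix_dominates(1)[OF Y S \<open>1 \<le> d\<close> \<sigma> content]) auto
    with i(2) have "S ! i ! j > Y ! i ! j" by simp
    moreover have "S ! i' ! j' = Y ! i' ! j'" if "j' < j" "i' < d" for i' j'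
      using less_j[OF that(1)] that(2) len by (metis nth_column)
    moreover have "j < length (S ! i)" using j i S by (simp add: is_tableau_row)
    ultimately have "neg_column_less S Y"
      unfolding neg_column_less_def using i(1) less_i len by blast
    then show ?thesis ..
  qed
qed

lemma permute_rows_id:
  "permute_rows (\<lambda>i\<in>{..<length Y}. id) Y = Y"
  by (rule nth_equalityI) (auto simp: permute_rows_def)

lemma neg_column_less_irrefl:
  assumes "is_tableau m n d S" "1 \<le> d"
  shows "\<not> neg_column_less S S"
  using assms by (simp add: neg_column_less_iff)

lemma det_coeff_self:
  assumes S: "is_tableau m n d S" "straight S" "1 \<le> d"
  shows "det_coeff n (content_monomial n S) S = 1"
proof -
  have len: "length S = d" using S by (simp add: is_tableau_length)
  have "{\<sigma>. \<sigma> \<in> all_row_perms n d \<and> content_monomial n (permute_rows \<sigma> S) = content_monomial n S} =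
      {\<lambda>i\<in>{..<d}. id}" (is "?A = _")
  proof (intro equalityI subsetI)
    fix \<sigma> assume "\<sigma> \<in> ?A"
    then show "\<sigma> \<in> {\<lambda>i\<in>{..<d}. id}"
      using straight_content_cases[OF S(1,2) S(1,2,3), of \<sigma>] neg_column_less_irrefl[OF S(1,3)] by auto
  next
    fix \<sigma> assume "\<sigma> \<in> {\<lambda>i\<in>{..<d}. (id :: nat \<Rightarrow> nat)}"
    then show "\<sigma> \<in> ?A"
      using permute_rows_id[of S] by (auto simp: all_row_perms_def len permutes_id)
  qed
  then show ?thesis unfolding det_coeff_def len by simp
qed

lemma det_coeff_neg_column_less:
  assumes "is_tableau m n d Y" "straight Y" "is_tableau m n d S" "straight S" "1 \<le> d"
    and "det_coeff n (content_monomial n S) Y \<noteq> 0" "S \<noteq> Y"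
  shows "neg_column_less S Y"
proof -
  have "length Y = d" using assms by (simp add: is_tableau_length)
  with assms(6) obtain \<sigma> where "\<sigma> \<in> all_row_perms n d"
    "content_monomial n (permute_rows \<sigma> Y) = content_monomial n S"
    unfolding det_coeff_def using sum.not_neutral_contains_not_neutral by blast
  with straight_content_cases[OF assms(1-5)] assms(7) show ?thesis by blast
qed

text \<open>
Column 0 of a tableau has as many entries as there are rows, so contents separate degrees.  This
is what excludes inhomogeneous straight expressions of a homogeneous bracket polynomial.
\<close>

lemma det_coeff_length:
  assumes "1 \<le> n" "length S \<noteq> length Y"
  shows "det_coeff n (content_monomial n S) Y = 0"
proof -
  have "content_monomial n (permute_rows \<sigma> Y) \<noteq> content_monomial n S" for \<sigma>
  proof
    assume "content_monomial n (permute_rows \<sigma> Y) = content_monomial n S"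
    then have "mset (column 0 (permute_rows \<sigma> Y)) = mset (column 0 S)"
      using assms(1) by (simp add: content_monomial_eq_iff)
    from mset_eq_length[OF this] assms(2) show False by simp
  qed
  then show ?thesis by (simp add: det_coeff_def)
qed

section \<open>Special bracket polynomials as coefficient vectors\<close>

lemma sorted_columns_eq:
  assumes "is_tableau m n d T" "1 \<le> d"
  shows "sorted_columns T = map (\<lambda>k. sort (column k T)) [0..<n]"
  by (simp add: sorted_columns_def transpose_tableau[OF assms])

text \<open>
Sorting the columns keeps their lengths and entries, so normalization stays within tableaux of
the same shape, and transposing it again recovers the sorted list of sorted columns.
\<close>

lemma column_normalization_tableau:
  assumes T: "is_tableau m n d T" and "1 \<le> d" "1 \<le> n"
  shows "is_tableau m n d (column_normalization T)"
    and "List.transpose (column_normalization T) = sort (sorted_columns T)"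
proof -
  define C where "C = sort (sorted_columns T)"
  have cols: "sorted_columns T = map (\<lambda>k. sort (column k T)) [0..<n]"
    using assms by (intro sorted_columns_eq)
  then have len: "length C = n" by (simp add: C_def)
  have set_C: "set C = set (sorted_columns T)" by (simp add: C_def)
  have C_nth: "length (C ! k) = d" "set (C ! k) \<subseteq> {1..m}" if "k < n" for k
  proof -
    have "C ! k \<in> set (sorted_columns T)" using that len set_C by (metis nth_mem)
    then obtain k' where k': "k' < n" "C ! k = sort (column k' T)" unfolding cols by auto
    then show "length (C ! k) = d" using T by (simp add: is_tableau_length)
    show "set (C ! k) \<subseteq> {1..m}"
      using T k' by (force simp: is_tableau_def column_def dest: nth_mem)
  qed
  have tr: "column_normalization T = map (\<lambda>i. map (\<lambda>k. C ! k ! i) [0..<n]) [0..<d]"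
    unfolding column_normalization_def C_def[symmetric]
    by (subst transpose_rectangle[where n = d]) (use len C_nth assms(3) in auto)
  have "C ! k ! i \<in> {1..m}" if "k < n" "i < d" for k i
    using C_nth[OF that(1)] that(2) by (metis nth_mem subsetD)
  then show tab: "is_tableau m n d (column_normalization T)"
    unfolding tr is_tableau_def by auto
  show "List.transpose (column_normalization T) = sort (sorted_columns T)"
    unfolding transpose_tableau[OF tab \<open>1 \<le> d\<close>] C_def[symmetric]
    by (intro nth_equalityI) (auto simp: len tr C_nth intro!: nth_equalityI)
qed

text \<open>
Already the entries in the first row tell the columns apart.
\<close>

lemma straight_transpose_strict:
  assumes N: "is_tableau m n d N" "straight N" "1 \<le> d"
  shows "sorted_wrt (<) (List.transpose N)"
proof -
  have "column j N < column k N" if "j < k" "k < n" for j k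
    using straight_row_less[OF N(1,2) _ that, of 0] N(3) is_tableau_length[OF N(1)]
      nth_column[of 0 N]
    by (subst list_less_iff_first_difference) (auto simp del: nth_column intro!: exI[of _ 0])
  then show ?thesis
    unfolding transpose_tableau[OF N(1,3)] by (auto simp: sorted_wrt_iff_nth_less)
qed

lemma column_normalization_eq_iff:
  assumes T: "is_tableau m n d T" and N: "is_tableau m n d N" "straight N" and dn: "1 \<le> d" "1 \<le> n"
  shows "column_normalization T = N \<longleftrightarrow> mset (sorted_columns T) = mset (List.transpose N)"
proof -
  note norm = column_normalization_tableau[OF T dn]
  have "column_normalization T = N \<longleftrightarrow> sort (sorted_columns T) = List.transpose N"
    using norm(2) transpose_tableau_inj[OF norm(1) N(1) dn(1)] by auto
  also have "\<dots> \<longleftrightarrow> mset (sorted_columns T) = mset (List.transpose N)"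
    using properties_for_sort[OF _ strict_sorted_imp_sorted[OF straight_transpose_strict[OF N dn(1)]]]
    by (metis mset_sort)
  finally show ?thesis .
qed

lemma permute_list_distinct_inj:
  assumes "distinct xs" "p permutes {..<length xs}" "q permutes {..<length xs}"
    and "permute_list p xs = permute_list q xs"
  shows "p = q"
proof
  fix k show "p k = q k"
  proof (cases "k < length xs")
    case True
    then have "xs ! p k = xs ! q k"
      using assms by (metis permute_list_nth)
    then show ?thesis
      using assms(1) True permutes_in_image[OF assms(2), of k] permutes_in_image[OF assms(3), of k]
      by (simp add: nth_eq_iff_index_eq)
  qed (use assms(2,3) in \<open>auto simp: permutes_def\<close>)
qed

text \<open>
The columns of a straight tableau are distinct, so only one permutation can arrange them; this
justifies the definite description in \<^const>\<open>column_perm\<close>.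
\<close>

lemma column_perm_unique:
  assumes T: "is_tableau m n d T" and N: "is_tableau m n d N" "straight N" and dn: "1 \<le> d" "1 \<le> n"
    and eq: "column_normalization T = N"
  shows "\<pi> = column_perm T \<longleftrightarrow>
    \<pi> permutes {..<n} \<and> permute_list \<pi> (sorted_columns T) = List.transpose N"
proof -
  have len: "length (sorted_columns T) = n"
    by (simp add: sorted_columns_eq[OF T dn(1)])
  have mset: "mset (sorted_columns T) = mset (List.transpose N)"
    using eq column_normalization_eq_iff[OF T N dn] by simp
  have sort: "sort (sorted_columns T) = List.transpose N"
    using column_normalization_tableau(2)[OF T dn] eq by simp
  have "distinct (List.transpose N)"
    using straight_transpose_strict[OF N dn(1)] strict_sorted_iff by blast
  then have dist: "distinct (sorted_columns T)"
    using mset_eq_imp_distinct_iff[OF mset] by simp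
  from mset_eq_permutation[OF mset[symmetric]] obtain p
    where p: "p permutes {..<n}" "permute_list p (sorted_columns T) = List.transpose N"
    unfolding len by blast
  have uniq: "q = p" if "q permutes {..<n}" "permute_list q (sorted_columns T) = List.transpose N" for q
    using permute_list_distinct_inj[OF dist] that p len by simp
  have "column_perm T = p"
    unfolding column_perm_def len sort by (rule the_equality) (use p uniq in blast)+
  then show ?thesis using p uniq by blast
qed

lemma row_perms_subset: "row_perms n d \<subseteq> all_row_perms n d"
  unfolding row_perms_def all_row_perms_def by (intro PiE_mono) (auto simp: permutes_id)

lemma finite_row_perms [simp]: "finite (row_perms n d)"
  using finite_subset[OF row_perms_subset] by simp

text \<open>
Composing every row permutation with the same \<open>\<pi>\<close> permutes the columns of the rearranged tableau
as a whole, so it does not change which entries share a column.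
\<close>

definition twist :: "nat \<Rightarrow> (nat \<Rightarrow> nat \<Rightarrow> nat) \<Rightarrow> (nat \<Rightarrow> nat) \<Rightarrow> nat \<Rightarrow> nat \<Rightarrow> nat" where
  "twist d \<sigma> \<pi> = (\<lambda>i\<in>{..<d}. \<sigma> i \<circ> \<pi>)"

lemma twist_in:
  assumes "\<sigma> \<in> all_row_perms n d" "\<pi> permutes {..<n}"
  shows "twist d \<sigma> \<pi> \<in> all_row_perms n d"
  using assms by (auto simp: twist_def all_row_perms_def intro: permutes_compose)

lemma twist_twist: "twist d (twist d \<sigma> \<pi>) \<rho> = twist d \<sigma> (\<pi> \<circ> \<rho>)"
  by (auto simp: twist_def fun_eq_iff)

lemma twist_id: "\<sigma> \<in> all_row_perms n d \<Longrightarrow> twist d \<sigma> id = \<sigma>"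
  by (auto simp: twist_def fun_eq_iff all_row_perms_def PiE_def extensional_def)

text \<open>
Twisting by \<open>\<pi>\<close> permutes the columns of the rearranged tableau by \<open>\<pi>\<close>.  Having the content of \<open>N\<close>
after that means that \<open>\<pi>\<close> arranges the sorted columns in the order in which they occur in \<open>N\<close>,
and for straight \<open>N\<close> this is the order chosen by the normalization.
\<close>

lemma content_twist_iff:
  assumes Y: "is_tableau m n d Y" and N: "is_tableau m n d N" "straight N" and dn: "1 \<le> d" "1 \<le> n"
    and \<tau>: "\<tau> \<in> all_row_perms n d" and \<pi>: "\<pi> permutes {..<n}"
  shows "content_monomial n (permute_rows (twist d \<tau> \<pi>) Y) = content_monomial n N \<longleftrightarrow>
    column_normalization (permute_rows \<tau> Y) = N \<and> column_perm (permute_rows \<tau> Y) = \<pi>"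
proof -
  define T where "T = permute_rows \<tau> Y"
  have T: "is_tableau m n d T"
    unfolding T_def using Y \<tau> by (rule is_tableau_permute_rows)
  have len: "length Y = d" "length T = d" "length N = d" "length (sorted_columns T) = n"
    using Y T N by (auto simp: is_tableau_length sorted_columns_eq[OF T dn(1)])
  have in_n: "\<pi> k < n" if "k < n" for k using permutes_in_image[OF \<pi>, of k] that by simp
  have col: "column k (permute_rows (twist d \<tau> \<pi>) Y) = column (\<pi> k) T" if "k < n" for k
    using permute_rows_row[OF Y \<tau>] permute_rows_row[OF Y twist_in[OF \<tau> \<pi>]] that in_n
    by (intro nth_equalityI) (auto simp: len T_def twist_def)
  have "content_monomial n (permute_rows (twist d \<tau> \<pi>) Y) = content_monomial n N \<longleftrightarrow>
      (\<forall>k < n. mset (column (\<pi> k) T) = mset (column k N))"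
    by (simp add: content_monomial_eq_iff col)
  also have "\<dots> \<longleftrightarrow> (\<forall>k < n. sort (column (\<pi> k) T) = column k N)"
    using straight_column_sorted[OF N(1) dn(1) N(2)] by (metis mset_sort properties_for_sort)
  also have "\<dots> \<longleftrightarrow> (\<forall>k < n. sorted_columns T ! \<pi> k = List.transpose N ! k)"
    using in_n by (simp add: sorted_columns_eq[OF T dn(1)] transpose_tableau[OF N(1) dn(1)])
  also have "\<dots> \<longleftrightarrow> permute_list \<pi> (sorted_columns T) = List.transpose N"
    using \<pi> by (auto simp: list_eq_iff_nth_eq len permute_list_nth transpose_tableau[OF N(1) dn(1)])
  also have "\<dots> \<longleftrightarrow> column_normalization T = N \<and> column_perm T = \<pi>"
  proof (cases "column_normalization T = N")
    case True
    then show ?thesis using column_perm_unique[OF T N dn True, of \<pi>] \<pi> by auto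
  next
    case False
    then have "mset (sorted_columns T) \<noteq> mset (List.transpose N)"
      using column_normalization_eq_iff[OF T N dn] by simp
    moreover have "mset (permute_list \<pi> (sorted_columns T)) = mset (sorted_columns T)"
      using \<pi> len by (intro mset_permute_list) simp
    ultimately show ?thesis using False by metis
  qed
  finally show ?thesis unfolding T_def .
qed

text \<open>
A family \<open>\<sigma>\<close> in the Leibniz expansion factors uniquely as \<open>\<tau>_i \<circ> \<pi>\<close> with \<open>\<tau>_0 = id\<close>, namely with
\<open>\<pi> = \<sigma>_0\<close>.  If the permuted tableau has the content of \<open>N\<close>, then \<open>\<pi>\<close> is the column permutation
of the normalization, and the sign of \<open>\<sigma>\<close> is the sign of \<open>\<tau>\<close> times \<open>sign \<pi>\<close> to the power \<open>d\<close>.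
\<close>

lemma lookup_SB:
  assumes Y: "is_tableau m n d Y" and N: "is_tableau m n d N" "straight N" and dn: "1 \<le> d" "1 \<le> n"
  shows "Poly_Mapping.lookup (SB n Y :: tableau \<Rightarrow>\<^sub>0 'a::comm_ring_1) N =
    of_int (det_coeff n (content_monomial n N) Y)"
proof -
  have len: "length Y = d" using Y by (rule is_tableau_length)
  define w where "w \<tau> = (\<Prod>i = 1..<d. sign (\<tau> i)) * sign (column_perm (permute_rows \<tau> Y)) ^ d" for \<tau>
  let ?N = "\<lambda>\<tau>. column_normalization (permute_rows \<tau> Y)"
  let ?A = "{\<tau> \<in> row_perms n d. ?N \<tau> = N}"
  let ?B = "{\<sigma>. \<sigma> \<in> all_row_perms n d \<and> content_monomial n (permute_rows \<sigma> Y) = content_monomial n N}"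
  have SUM: "(\<Sum>\<tau>\<in>?A. w \<tau>) = (\<Sum>\<sigma>\<in>?B. \<Prod>i<d. sign (\<sigma> i))"
  proof (rule sum.reindex_bij_witness[of _ "\<lambda>\<sigma>. twist d \<sigma> (Hilbert_Choice.inv (\<sigma> 0))"
        "\<lambda>\<tau>. twist d \<tau> (column_perm (permute_rows \<tau> Y))"])
    fix \<tau> assume "\<tau> \<in> ?A"
    then have \<tau>: "\<tau> \<in> row_perms n d" "\<tau> \<in> all_row_perms n d" "?N \<tau> = N"
      using row_perms_subset by auto
    define \<pi> where "\<pi> = column_perm (permute_rows \<tau> Y)"
    have \<pi>: "\<pi> permutes {..<n}"
      using column_perm_unique[OF is_tableau_permute_rows[OF Y \<tau>(2)] N dn \<tau>(3), of \<pi>]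
      by (simp add: \<pi>_def)
    have \<tau>0: "\<tau> 0 = id" using \<tau>(1) dn by (auto simp: row_perms_def PiE_def Pi_def)
    then have "twist d \<tau> \<pi> 0 = \<pi>" using dn by (simp add: twist_def)
    then show "twist d (twist d \<tau> (column_perm (permute_rows \<tau> Y)))
        (Hilbert_Choice.inv (twist d \<tau> (column_perm (permute_rows \<tau> Y)) 0)) = \<tau>"
      using twist_id[OF \<tau>(2)] permutes_inv_o[OF \<pi>] by (simp add: \<pi>_def[symmetric] twist_twist)
    show "twist d \<tau> (column_perm (permute_rows \<tau> Y)) \<in> ?B"
      using twist_in[OF \<tau>(2) \<pi>] content_twist_iff[OF Y N dn \<tau>(2) \<pi>] \<tau>(3) by (simp add: \<pi>_def)
    have perm: "permutation (\<tau> i)" if "i < d" for i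
      using all_row_perms_permutes[OF \<tau>(2) that] permutation_permutes by blast
    have "permutation \<pi>" using \<pi> permutation_permutes by blast
    with perm have "(\<Prod>i<d. sign (twist d \<tau> \<pi> i)) = (\<Prod>i<d. sign (\<tau> i) * sign \<pi>)"
      by (intro prod.cong refl) (auto simp: twist_def sign_compose)
    also have "\<dots> = (\<Prod>i<d. sign (\<tau> i)) * sign \<pi> ^ d" by (simp add: prod.distrib)
    also have "(\<Prod>i<d. sign (\<tau> i)) = (\<Prod>i = 1..<d. sign (\<tau> i))"
    proof -
      have "{..<d} = insert 0 {1..<d}" using dn by auto
      then show ?thesis using \<tau>0 by simp
    qed
    finally show "(\<Prod>i<d. sign (twist d \<tau> (column_perm (permute_rows \<tau> Y)) i)) = w \<tau>"
      by (simp add: w_def \<pi>_def)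
  next
    fix \<sigma> assume "\<sigma> \<in> ?B"
    then have \<sigma>: "\<sigma> \<in> all_row_perms n d"
      "content_monomial n (permute_rows \<sigma> Y) = content_monomial n N" by auto
    have \<sigma>0: "\<sigma> 0 permutes {..<n}" using \<sigma>(1) dn by (intro all_row_perms_permutes) auto
    define \<tau> where "\<tau> = twist d \<sigma> (Hilbert_Choice.inv (\<sigma> 0))"
    have \<tau>: "\<tau> \<in> all_row_perms n d"
      unfolding \<tau>_def using \<sigma>(1) permutes_inv[OF \<sigma>0] by (rule twist_in)
    have untwist: "twist d \<tau> (\<sigma> 0) = \<sigma>"
      unfolding \<tau>_def twist_twist using permutes_inv_o[OF \<sigma>0] twist_id[OF \<sigma>(1)] by simp
    have norm: "?N \<tau> = N" "column_perm (permute_rows \<tau> Y) = \<sigma> 0"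
      using content_twist_iff[OF Y N dn \<tau> \<sigma>0] \<sigma>(2) unfolding untwist by auto
    show "twist d (twist d \<sigma> (Hilbert_Choice.inv (\<sigma> 0))) (column_perm (permute_rows (twist d \<sigma> (Hilbert_Choice.inv (\<sigma> 0))) Y)) = \<sigma>"
      using norm untwist by (simp add: \<tau>_def)
    have "\<tau> 0 = id" using dn permutes_inv_o[OF \<sigma>0] by (simp add: \<tau>_def twist_def)
    with \<tau> have "\<tau> \<in> row_perms n d"
      by (auto simp: row_perms_def all_row_perms_def PiE_def Pi_def)
    with norm show "twist d \<sigma> (Hilbert_Choice.inv (\<sigma> 0)) \<in> ?A" by (simp add: \<tau>_def)
  qed
  have "Poly_Mapping.lookup (SB n Y :: tableau \<Rightarrow>\<^sub>0 'a) N =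
      (\<Sum>\<tau> | \<tau> \<in> row_perms n d \<and> straight (?N \<tau>). if ?N \<tau> = N then of_int (w \<tau>) else 0)"
    by (simp add: SB_def len Let_def lookup_sum lookup_single when_def w_def
        cong: if_cong del: of_int_mult of_int_power of_int_prod)
  also have "\<dots> = (\<Sum>\<tau>\<in>?A. of_int (w \<tau>))"
    by (intro sum.mono_neutral_cong_right) (use N in auto)
  also have "\<dots> = of_int (\<Sum>\<tau>\<in>?A. w \<tau>)" by simp
  also have "(\<Sum>\<tau>\<in>?A. w \<tau>) = det_coeff n (content_monomial n N) Y"
    unfolding det_coeff_def len by (rule SUM)
  finally show ?thesis .
qed

lemma keys_SB:
  assumes Y: "is_tableau m n d Y" and dn: "1 \<le> d" "1 \<le> n"
    and "N \<in> Poly_Mapping.keys (SB n Y :: tableau \<Rightarrow>\<^sub>0 'a::comm_ring_1)"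
  shows "is_tableau m n d N \<and> straight N"
proof -
  have len: "length Y = d" using Y by (rule is_tableau_length)
  have "N \<in> (\<Union>\<tau>\<in>{\<tau> \<in> row_perms n d. straight (column_normalization (permute_rows \<tau> Y))}.
      {column_normalization (permute_rows \<tau> Y)})"
    using assms(4) unfolding SB_def len Let_def
    by (auto dest!: subsetD[OF keys_sum] split: if_splits)
  then obtain \<tau> where "\<tau> \<in> row_perms n d" "N = column_normalization (permute_rows \<tau> Y)" "straight N"
    by auto
  then show ?thesis
    using column_normalization_tableau(1)[OF is_tableau_permute_rows[OF Y] dn] row_perms_subset by auto
qed

section \<open>The negative column order and linear independence\<close>

lemma neg_column_less_trans:
  assumes "is_tableau m n d F" "is_tableau m n d G" "is_tableau m n d H" "1 \<le> d"
    and "neg_column_less F G" "neg_column_less G H"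
  shows "neg_column_less F H"
  using assms by (auto simp: neg_column_less_iff)

lemma neg_column_less_asym:
  assumes "is_tableau m n d F" "is_tableau m n d G" "1 \<le> d" "neg_column_less F G"
  shows "\<not> neg_column_less G F"
  using assms by (auto simp: neg_column_less_iff)

lemma ex_largest_tableau:
  assumes "finite A" "A \<noteq> {}" "\<And>Y. Y \<in> A \<Longrightarrow> is_tableau m n d Y" "1 \<le> d"
  shows "\<exists>F \<in> A. \<forall>G \<in> A. G \<noteq> F \<longrightarrow> neg_column_less G F"
proof -
  define F where "F = arg_min_on List.transpose A"
  have F: "F \<in> A" "\<not> (\<exists>G \<in> A. List.transpose G < List.transpose F)"
    unfolding F_def using arg_min_if_finite[OF assms(1,2)] by auto
  have "neg_column_less G F" if "G \<in> A" "G \<noteq> F" for G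
  proof -
    have "List.transpose F \<noteq> List.transpose G"
      using transpose_tableau_inj[of m n d F G] that F(1) assms(3,4) by blast
    then have "List.transpose F < List.transpose G"
      using F(2) that(1) by (meson linorder_neqE)
    then show ?thesis
      using neg_column_less_iff[of m n d G F] that F(1) assms(3,4) by blast
  qed
  with F(1) show ?thesis by blast
qed

lemma LM_largest:
  assumes "q \<noteq> 0" "\<And>Y. Y \<in> Poly_Mapping.keys q \<Longrightarrow> is_tableau m n d Y" "1 \<le> d"
  shows "LM q \<in> Poly_Mapping.keys q"
    and "\<And>G. G \<in> Poly_Mapping.keys q \<Longrightarrow> G \<noteq> LM q \<Longrightarrow> neg_column_less G (LM q)"
proof -
  have "Poly_Mapping.keys q \<noteq> {}" using assms(1) by simp
  from ex_largest_tableau[OF finite_keys this assms(2,3)] obtain F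
    where F: "F \<in> Poly_Mapping.keys q"
      "\<forall>G \<in> Poly_Mapping.keys q. G \<noteq> F \<longrightarrow> neg_column_less G F" by blast
  have "LM q = F"
    unfolding LM_def
  proof (rule the_equality)
    fix F' assume F': "F' \<in> Poly_Mapping.keys q \<and>
      (\<forall>G \<in> Poly_Mapping.keys q. G \<noteq> F' \<longrightarrow> neg_column_less G F')"
    show "F' = F"
    proof (rule ccontr)
      assume "F' \<noteq> F"
      with F F' have "neg_column_less F F'" "neg_column_less F' F" by auto
      then show False
        using neg_column_less_asym[of m n d F F'] F(1) F' assms(2,3) by blast
    qed
  qed (use F in blast)
  with F show "LM q \<in> Poly_Mapping.keys q"
    and "\<And>G. G \<in> Poly_Mapping.keys q \<Longrightarrow> G \<noteq> LM q \<Longrightarrow> neg_column_less G (LM q)" by auto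
qed

lemma det_coeff_Nil: "det_coeff n (content_monomial n []) [] = 1"
proof -
  \<comment> \<open>There is one family indexed by the empty set, the function that is undefined everywhere.\<close>
  have "{\<sigma>. \<sigma> \<in> all_row_perms n 0 \<and> content_monomial n (permute_rows \<sigma> []) = content_monomial n []} =
      {\<lambda>_. undefined}"
    by (auto simp: all_row_perms_def permute_rows_def)
  then show ?thesis by (simp add: det_coeff_def)
qed

text \<open>
Linear independence of straight monomials, allowing different degrees: the content of the
largest tableau \<open>S\<close> of some degree with nonzero coefficient occurs, by triangularity, only in the
determinant product of \<open>S\<close> itself, and there with coefficient 1.
\<close>

lemma straight_combination_zero:
  fixes f :: "tableau \<Rightarrow> 'a::comm_ring_1"
  assumes "finite T" and T: "\<And>Y. Y \<in> T \<Longrightarrow> is_tableau m n (length Y) Y \<and> straight Y" and "1 \<le> n"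
    and zero: "\<And>S. S \<in> T \<Longrightarrow> (\<Sum>Y\<in>T. f Y * of_int (det_coeff n (content_monomial n S) Y)) = 0"
    and "Y0 \<in> T"
  shows "f Y0 = 0"
proof (rule ccontr)
  assume "f Y0 \<noteq> 0"
  define d where "d = length Y0"
  define A where "A = {Y \<in> T. f Y \<noteq> 0 \<and> length Y = d}"
  have A: "finite A" "A \<noteq> {}" "\<And>Y. Y \<in> A \<Longrightarrow> is_tableau m n d Y \<and> straight Y"
    using \<open>finite T\<close> \<open>Y0 \<in> T\<close> \<open>f Y0 \<noteq> 0\<close> T by (auto simp: A_def d_def) metis
  have "\<exists>S \<in> A. det_coeff n (content_monomial n S) S = 1 \<and>
    (\<forall>Y \<in> A. Y \<noteq> S \<longrightarrow> det_coeff n (content_monomial n S) Y = 0)"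
  proof (cases "d = 0")
    case True
    then have "Y = []" if "Y \<in> A" for Y using that by (simp add: A_def)
    with A(2) show ?thesis using det_coeff_Nil[of n] by blast
  next
    case False
    then have d: "1 \<le> d" by simp
    with ex_largest_tableau[of A m n d] A obtain S
      where S: "S \<in> A" "\<forall>G \<in> A. G \<noteq> S \<longrightarrow> neg_column_less G S" by blast
    have "det_coeff n (content_monomial n S) Y = 0" if Y: "Y \<in> A" "Y \<noteq> S" for Y
    proof (rule ccontr)
      assume "det_coeff n (content_monomial n S) Y \<noteq> 0"
      then have "neg_column_less S Y"
        using det_coeff_neg_column_less[of m n d Y S] A(3)[OF Y(1)] A(3)[OF S(1)] d Y(2) by blast
      moreover have "neg_column_less Y S" using S(2) Y by blast
      ultimately show False
        using neg_column_less_asym[of m n d S Y] A(3)[OF Y(1)] A(3)[OF S(1)] d by blast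
    qed
    with S(1) show ?thesis using det_coeff_self[of m n d S] A(3)[OF S(1)] d by blast
  qed
  then obtain S where S: "S \<in> A" "det_coeff n (content_monomial n S) S = 1"
    "\<And>Y. Y \<in> A \<Longrightarrow> Y \<noteq> S \<Longrightarrow> det_coeff n (content_monomial n S) Y = 0" by blast
  have "S \<in> T" "f S \<noteq> 0" "length S = d" using S(1) by (auto simp: A_def)
  have "f Y * of_int (det_coeff n (content_monomial n S) Y) = 0" if "Y \<in> T" "Y \<noteq> S" for Y
  proof (cases "length Y = d")
    case True
    then show ?thesis using S(3)[of Y] that by (cases "f Y = 0") (auto simp: A_def)
  next
    case False
    then show ?thesis
      using det_coeff_length[OF \<open>1 \<le> n\<close>, of S Y] \<open>length S = d\<close> by simp
  qed
  then have "(\<Sum>Y\<in>T. f Y * of_int (det_coeff n (content_monomial n S) Y)) =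
      (\<Sum>Y\<in>{S}. f Y * of_int (det_coeff n (content_monomial n S) Y))"
    using \<open>finite T\<close> \<open>S \<in> T\<close> by (intro sum.mono_neutral_right) auto
  with zero[OF \<open>S \<in> T\<close>] S(2) \<open>f S \<noteq> 0\<close> show False by simp
qed

section \<open>Termination and partial correctness of the algorithm\<close>

definition straight_tableaux :: "nat \<Rightarrow> nat \<Rightarrow> nat \<Rightarrow> tableau set" where
  "straight_tableaux m n d = {Y. is_tableau m n d Y \<and> straight Y}"

lemma finite_straight_tableaux [simp]: "finite (straight_tableaux m n d)"
  using finite_tableaux[of m n d] by (rule rev_finite_subset) (auto simp: straight_tableaux_def)

text \<open>
The coefficient of \<open>\<mu>\<close> in the image of the linear combination \<open>g\<close> under substitution of
determinants for brackets.
\<close>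

definition det_expansion ::
    "nat \<Rightarrow> (tableau \<Rightarrow>\<^sub>0 'a::comm_ring_1) \<Rightarrow> (nat \<times> nat \<Rightarrow>\<^sub>0 nat) \<Rightarrow> 'a" where
  "det_expansion n g \<mu> = (\<Sum>Y \<in> Poly_Mapping.keys g. Poly_Mapping.lookup g Y * of_int (det_coeff n \<mu> Y))"

lemma det_expansion_superset:
  assumes "finite A" "Poly_Mapping.keys g \<subseteq> A"
  shows "det_expansion n g \<mu> = (\<Sum>Y \<in> A. Poly_Mapping.lookup g Y * of_int (det_coeff n \<mu> Y))"
  unfolding det_expansion_def
  using assms by (intro sum.mono_neutral_left) (auto simp: in_keys_iff)

lemma det_expansion_add_single:
  "det_expansion n (g + Poly_Mapping.single Y c) \<mu> =
     det_expansion n g \<mu> + c * of_int (det_coeff n \<mu> Y)"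
proof -
  define A where "A = insert Y (Poly_Mapping.keys g)"
  have A: "finite A" "Y \<in> A" "Poly_Mapping.keys g \<subseteq> A" by (auto simp: A_def)
  have "Poly_Mapping.keys (g + Poly_Mapping.single Y c) \<subseteq> A"
    by (auto simp: A_def dest!: subsetD[OF keys_add] split: if_splits)
  then have "det_expansion n (g + Poly_Mapping.single Y c) \<mu> =
      (\<Sum>Z\<in>A. Poly_Mapping.lookup g Z * of_int (det_coeff n \<mu> Z) +
        (if Z = Y then c * of_int (det_coeff n \<mu> Y) else 0))"
    using A by (simp add: det_expansion_superset lookup_add lookup_single when_def algebra_simps
        if_distrib cong: if_cong) (auto simp: algebra_simps intro!: sum.cong)
  also have "\<dots> = det_expansion n g \<mu> + c * of_int (det_coeff n \<mu> Y)"
    using A by (simp add: sum.distrib det_expansion_superset[OF A(1,3)])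
  finally show ?thesis .
qed

lemma lookup_scale: "Poly_Mapping.lookup (scale c q) Y = c * Poly_Mapping.lookup q Y"
  for q :: "'b \<Rightarrow>\<^sub>0 ('a::comm_ring_1)"
  by (simp add: scale_def Poly_Mapping.map.rep_eq when_def)

text \<open>
The largest monomial cancels because its coefficient in its own special bracket polynomial is 1,
and all other monomials of that polynomial are smaller.
\<close>

lemma straightening_step:
  fixes q :: "tableau \<Rightarrow>\<^sub>0 'a::comm_ring_1"
  assumes "q \<noteq> 0" "Poly_Mapping.keys q \<subseteq> straight_tableaux m n d" "1 \<le> d" "1 \<le> n"
    and "K \<in> Poly_Mapping.keys (q - scale (LC q) (SB n (LM q)))"
  shows "K \<in> straight_tableaux m n d \<and> neg_column_less K (LM q)"
proof -
  have LM: "LM q \<in> Poly_Mapping.keys q"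
    "\<And>G. G \<in> Poly_Mapping.keys q \<Longrightarrow> G \<noteq> LM q \<Longrightarrow> neg_column_less G (LM q)"
    using LM_largest[of q m n d] assms by (auto simp: straight_tableaux_def)
  then have str: "is_tableau m n d (LM q)" "straight (LM q)"
    using assms(2) by (auto simp: straight_tableaux_def)
  have lookup: "Poly_Mapping.lookup q K - LC q * Poly_Mapping.lookup (SB n (LM q)) K \<noteq> 0"
    using assms(5) by (simp add: in_keys_iff lookup_minus lookup_scale)
  have "K \<noteq> LM q"
    using lookup lookup_SB[OF str(1) str assms(3,4), where 'a = 'a] det_coeff_self[OF str assms(3)]
    by (auto simp: LC_def)
  from lookup consider "K \<in> Poly_Mapping.keys q"
    | "K \<in> Poly_Mapping.keys (SB n (LM q) :: tableau \<Rightarrow>\<^sub>0 'a)"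
    by (metis in_keys_iff diff_zero mult_zero_right)
  then show ?thesis
  proof cases
    case 1
    then show ?thesis using LM(2) \<open>K \<noteq> LM q\<close> assms(2) by blast
  next
    case 2
    then have K: "is_tableau m n d K" "straight K"
      using keys_SB[OF str(1) assms(3,4)] by auto
    have "det_coeff n (content_monomial n K) (LM q) \<noteq> 0"
      using 2 lookup_SB[OF str(1) K assms(3,4), where 'a = 'a] by (auto simp: in_keys_iff)
    then show ?thesis
      using det_coeff_neg_column_less[OF str K assms(3)] \<open>K \<noteq> LM q\<close> K
      by (simp add: straight_tableaux_def)
  qed
qed

text \<open>
The loop preserves \<open>q + SB(g)\<close>, and the number of straight tableaux not larger than \<open>LM(q)\<close>
decreases.  Only leading coefficients 1 are ever cancelled, so the coefficients may come from any
commutative ring; the integers are needed later.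
\<close>

theorem straightening_algorithm_terminates:
  fixes \<alpha> :: "nat \<Rightarrow> 'a::comm_ring_1"
  assumes "1 \<le> d" "1 \<le> n" and X: "\<And>i. i \<in> {1..M} \<Longrightarrow> is_tableau m n d (X i)"
  shows "\<exists>g. straightening_algorithm n M \<alpha> X = Some g \<and>
    Poly_Mapping.keys g \<subseteq> straight_tableaux m n d \<and>
    (\<forall>N \<in> straight_tableaux m n d. det_expansion n g (content_monomial n N) =
      (\<Sum>i = 1..M. \<alpha> i * of_int (det_coeff n (content_monomial n N) (X i))))"
proof -
  let ?St = "straight_tableaux m n d"
  define q0 where "q0 = (\<Sum>i = 1..M. scale (\<alpha> i) (SB n (X i)))"
  define b where "b = (\<lambda>(q :: tableau \<Rightarrow>\<^sub>0 'a, g :: tableau \<Rightarrow>\<^sub>0 'a). q \<noteq> 0)"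
  define c where "c = (\<lambda>(q :: tableau \<Rightarrow>\<^sub>0 'a, g).
    (q - scale (LC q) (SB n (LM q)), g + Poly_Mapping.single (LM q) (LC q)))"
  define I where "I = (\<lambda>(q :: tableau \<Rightarrow>\<^sub>0 'a, g). Poly_Mapping.keys q \<subseteq> ?St \<and>
    Poly_Mapping.keys g \<subseteq> ?St \<and>
    (\<forall>N \<in> ?St. Poly_Mapping.lookup q N + det_expansion n g (content_monomial n N) =
      Poly_Mapping.lookup q0 N))"
  \<comment> \<open>The straight tableaux that are at most \<open>LM q\<close>, described without reference to \<open>LM\<close> so that the
    set makes sense for \<open>q = 0\<close> too.\<close>
  define below where "below q = {S \<in> ?St. \<exists>K \<in> Poly_Mapping.keys q. S = K \<or> neg_column_less S K}"
    for q :: "tableau \<Rightarrow>\<^sub>0 'a"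
  have q0_lookup: "Poly_Mapping.lookup q0 N =
      (\<Sum>i = 1..M. \<alpha> i * of_int (det_coeff n (content_monomial n N) (X i)))" if "N \<in> ?St" for N
  proof -
    have "Poly_Mapping.lookup (SB n (X i) :: tableau \<Rightarrow>\<^sub>0 'a) N = of_int (det_coeff n (content_monomial n N) (X i))"
      if "i \<in> {1..M}" for i
      using lookup_SB[OF X[OF that] _ _ assms(1,2), where 'a = 'a] \<open>N \<in> ?St\<close> by (simp add: straight_tableaux_def)
    then show ?thesis by (simp add: q0_def lookup_sum lookup_scale)
  qed
  have q0_keys: "Poly_Mapping.keys q0 \<subseteq> ?St"
  proof
    fix N assume "N \<in> Poly_Mapping.keys q0"
    then have "(\<Sum>i = 1..M. \<alpha> i * Poly_Mapping.lookup (SB n (X i)) N) \<noteq> 0"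
      by (simp add: q0_def in_keys_iff lookup_sum lookup_scale)
    then obtain i where "i \<in> {1..M}" "\<alpha> i * Poly_Mapping.lookup (SB n (X i)) N \<noteq> 0"
      using sum.not_neutral_contains_not_neutral by blast
    then show "N \<in> ?St"
      using keys_SB[OF X assms(1,2), of i N, where 'a = 'a]
      by (cases "Poly_Mapping.lookup (SB n (X i) :: tableau \<Rightarrow>\<^sub>0 'a) N = 0")
         (auto simp: straight_tableaux_def in_keys_iff)
  qed
  have init: "I (q0, 0)"
    using q0_keys by (simp add: I_def det_expansion_def)
  have step: "I (c s) \<and> card (below (fst (c s))) < card (below (fst s))" if inv: "I s" "b s" for s
  proof -
    obtain q g where s: "s = (q, g)" by (cases s)
    define q' where "q' = q - scale (LC q) (SB n (LM q))"
    have q: "q \<noteq> 0" "Poly_Mapping.keys q \<subseteq> ?St"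
      using inv by (auto simp: s I_def b_def)
    have LM: "LM q \<in> Poly_Mapping.keys q" "LM q \<in> ?St"
      using LM_largest[of q m n d] q assms(1) by (auto simp: straight_tableaux_def)
    have str: "is_tableau m n d (LM q)" "straight (LM q)"
      using LM(2) by (auto simp: straight_tableaux_def)
    have new: "K \<in> ?St \<and> neg_column_less K (LM q)" if "K \<in> Poly_Mapping.keys q'" for K
      using straightening_step[OF q assms(1,2)] that by (simp add: q'_def)
    have "Poly_Mapping.lookup q' N +
        det_expansion n (g + Poly_Mapping.single (LM q) (LC q)) (content_monomial n N) =
        Poly_Mapping.lookup q N + det_expansion n g (content_monomial n N)" if "N \<in> ?St" for N
      using lookup_SB[OF str(1) _ _ assms(1,2), of N, where 'a = 'a] that
      by (simp add: q'_def lookup_minus lookup_scale det_expansion_add_single straight_tableaux_def)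
    moreover have "Poly_Mapping.keys (g + Poly_Mapping.single (LM q) (LC q)) \<subseteq> ?St"
      using inv LM(2) by (auto simp: s I_def dest!: subsetD[OF keys_add] split: if_splits)
    moreover have "Poly_Mapping.keys q' \<subseteq> ?St" using new by blast
    ultimately have "I (c s)"
      using inv by (simp add: s I_def c_def q'_def)
    moreover have "below q' \<subset> below q"
    proof (rule psubsetI)
      show "below q' \<subseteq> below q"
      proof
        fix S assume "S \<in> below q'"
        then obtain K where K: "S \<in> ?St" "K \<in> Poly_Mapping.keys q'" "S = K \<or> neg_column_less S K"
          by (auto simp: below_def)
        then have "neg_column_less S (LM q)"
          using new[OF K(2)] neg_column_less_trans[of m n d S K "LM q"] str assms(1)
          by (auto simp: straight_tableaux_def)
        then show "S \<in> below q" using K(1) LM(1) by (auto simp: below_def)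
      qed
      have "LM q \<notin> below q'"
      proof
        assume "LM q \<in> below q'"
        then obtain K where K: "K \<in> Poly_Mapping.keys q'" "LM q = K \<or> neg_column_less (LM q) K"
          by (auto simp: below_def)
        then show False
          using new[OF K(1)] neg_column_less_asym[of m n d K "LM q"] str assms(1)
            neg_column_less_irrefl[of m n d "LM q"]
          by (auto simp: straight_tableaux_def)
      qed
      moreover have "LM q \<in> below q" using LM by (auto simp: below_def)
      ultimately show "below q' \<noteq> below q" by blast
    qed
    then have "card (below q') < card (below q)"
      by (intro psubset_card_mono) (auto simp: below_def)
    ultimately show ?thesis by (simp add: s c_def q'_def)
  qed
  from measure_while_option_Some[where P = I and b = b and c = c and f = "\<lambda>s. card (below (fst s))" and s = "(q0, 0)",
      OF step init]
  obtain t where t: "while_option b c (q0, 0) = Some t" by blast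
  have "I t"
    using while_option_rule[where P = I, OF _ t init] step by blast
  moreover have "\<not> b t" using while_option_stop[OF t] .
  ultimately have "Poly_Mapping.keys (snd t) \<subseteq> ?St"
    "\<forall>N \<in> ?St. det_expansion n (snd t) (content_monomial n N) = Poly_Mapping.lookup q0 N"
    by (auto simp: I_def b_def split: prod.splits)
  moreover have "straightening_algorithm n M \<alpha> X = Some (snd t)"
    unfolding straightening_algorithm_def using t unfolding q0_def b_def c_def by simp
  ultimately show ?thesis using q0_lookup by auto
qed

section \<open>The straightening law over the rationals\<close>

lemma bracket_det_permute:
  assumes p: "p permutes {..<n}" and len: "length R = n"
  shows "(bracket_det n (permute_list p R) :: (_, 'a::comm_ring_1) mpoly) =
    of_int (sign p) * bracket_det n R"
proof -
  let ?f = "\<lambda>q. of_int (sign q) * (\<Prod>k<n. Var (R ! q k, Suc k)) :: (_, 'a) mpoly"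
  have perm: "permutation r" if "r permutes {..<n}" for r :: "nat \<Rightarrow> nat"
    using that permutation_permutes by blast
  have "of_int (sign p) * bracket_det n R = (\<Sum>q | q permutes {..<n}. of_int (sign p) * ?f (p \<circ> q))"
    unfolding bracket_det_conv_rows sum_distrib_left[symmetric]
    by (subst setum_permutations_compose_left[OF p]) simp
  also have "\<dots> = (\<Sum>q | q permutes {..<n}. of_int (sign q) *
      (\<Prod>k<n. Var (permute_list p R ! q k, Suc k)))"
  proof (intro sum.cong refl)
    fix q assume "q \<in> {q. q permutes {..<n}}"
    then have q: "q permutes {..<n}" by simp
    have "sign p * sign (p \<circ> q) = sign q"
      using perm[OF p] perm[OF q] by (simp add: sign_compose flip: mult.assoc)
    then have "of_int (sign p) * (of_int (sign (p \<circ> q)) * x) = of_int (sign q) * x"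
      for x :: "(nat \<times> nat, 'a) mpoly"
      by (metis mult.assoc of_int_mult)
    moreover have "permute_list p R ! q k = R ! (p \<circ> q) k" if "k < n" for k
      using permute_list_nth[of p R "q k"] p len permutes_in_image[OF q, of k] that by simp
    ultimately show "of_int (sign p) * ?f (p \<circ> q) = of_int (sign q) *
      (\<Prod>k<n. Var (permute_list p R ! q k, Suc k))" by simp
  qed
  finally show ?thesis unfolding bracket_det_conv_rows by simp
qed

text \<open>
Antisymmetry under a transposition yields \<open>p = - p\<close>; over the rationals this means vanishing.
\<close>

lemma eq_uminus_imp_zero:
  fixes p :: "(nat \<times> nat, rat) mpoly"
  assumes "p = - p"
  shows "p = 0"
proof (rule poly_mapping_eqI)
  fix \<mu>
  have "Poly_Mapping.lookup p \<mu> = - Poly_Mapping.lookup p \<mu>" by (metis assms lookup_uminus)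
  then show "Poly_Mapping.lookup p \<mu> = Poly_Mapping.lookup 0 \<mu>" by simp
qed

lemma bracket_det_repeated:
  assumes len: "length R = n" and "\<not> distinct R"
  shows "(bracket_det n R :: (_, rat) mpoly) = 0"
proof -
  from assms obtain a b where ab: "a < n" "b < n" "a \<noteq> b" "R ! a = R ! b"
    by (auto simp: distinct_conv_nth)
  let ?t = "Transposition.transpose a b"
  have t: "?t permutes {..<n}" using ab by (intro permutes_swap_id) auto
  have "permute_list ?t R = R"
    using t ab len by (intro nth_equalityI) (auto simp: permute_list_nth transpose_def)
  then show ?thesis
    using bracket_det_permute[OF t len, where 'a = rat] ab
    by (intro eq_uminus_imp_zero) (simp add: sign_swap_id)
qed

text \<open>
Composing \<open>\<sigma>\<close> with the transposition of \<open>a\<close> and \<open>b\<close> does not change the product, as the two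
positions carry the same coordinate, but flips the sign.
\<close>

lemma alternating_sum_zero:
  fixes g :: "nat \<Rightarrow> nat \<Rightarrow> (nat \<times> nat, rat) mpoly"
  assumes "finite L" "Z \<subseteq> L" "a \<in> Z" "b \<in> Z" "a \<noteq> b" "\<kappa> a = \<kappa> b"
  shows "(\<Sum>\<sigma> | \<sigma> permutes Z. of_int (sign \<sigma>) * (\<Prod>l\<in>L. g (\<sigma> l) (\<kappa> l))) = 0"
proof (rule eq_uminus_imp_zero)
  let ?f = "\<lambda>\<sigma>. of_int (sign \<sigma>) * (\<Prod>l\<in>L. g (\<sigma> l) (\<kappa> l))"
  let ?t = "Transposition.transpose a b"
  have finZ: "finite Z" using assms(1,2) finite_subset by blast
  have t: "?t permutes Z" using assms by (intro permutes_swap_id) auto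
  have tL: "?t permutes L" using t assms(2) by (rule permutes_subset)
  have "?f (\<sigma> \<circ> ?t) = - ?f \<sigma>" if "\<sigma> permutes Z" for \<sigma>
  proof -
    have "permutation \<sigma>" using that finZ permutation_permutes by blast
    moreover have "permutation ?t" by (simp add: permutation_swap_id)
    ultimately have "sign (\<sigma> \<circ> ?t) = - sign \<sigma>"
      using assms(5) by (simp add: sign_compose sign_swap_id)
    moreover have "(\<Prod>l\<in>L. g ((\<sigma> \<circ> ?t) l) (\<kappa> l)) = (\<Prod>l\<in>L. g (\<sigma> (?t l)) (\<kappa> (?t l)))"
      using assms(6) by (intro prod.cong) (auto simp: transpose_def)
    moreover have "\<dots> = (\<Prod>l\<in>L. g (\<sigma> l) (\<kappa> l))"
      using prod.permute[OF tL, of "\<lambda>l. g (\<sigma> l) (\<kappa> l)"] by (simp add: o_def)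
    ultimately show ?thesis by simp
  qed
  then show "(\<Sum>\<sigma> | \<sigma> permutes Z. ?f \<sigma>) = - (\<Sum>\<sigma> | \<sigma> permutes Z. ?f \<sigma>)"
    by (subst sum_permutations_compose_right[OF t]) (simp add: sum_negf)
qed

lemma bracket_det_pair:
  assumes "length W = 2 * n"
  shows "(bracket_det n (take n W) * bracket_det n (drop n W) :: (_, 'a::comm_ring_1) mpoly) =
    (\<Sum>p | p permutes {..<n}. \<Sum>q | q permutes {..<n}. of_int (sign p * sign q) *
      (\<Prod>l<2 * n. Var (W ! l, Suc (if l < n then p l else q (l - n)))))"
proof -
  have prod: "(\<Prod>l<2 * n. Var (W ! l, Suc (if l < n then p l else q (l - n)))) =
      (\<Prod>j<n. Var (take n W ! j, Suc (p j))) * (\<Prod>j<n. (Var (drop n W ! j, Suc (q j)) :: (_, 'a) mpoly))"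
    for p q :: "nat \<Rightarrow> nat"
  proof -
    have "{..<2 * n} = {..<n} \<union> {n..<2 * n}" by auto
    then have "(\<Prod>l<2 * n. Var (W ! l, Suc (if l < n then p l else q (l - n)))) =
        (\<Prod>l<n. Var (W ! l, Suc (p l))) * (\<Prod>l\<in>{n..<2 * n}. (Var (W ! l, Suc (q (l - n))) :: (_, 'a) mpoly))"
      by (simp add: prod.union_disjoint ivl_disj_int_one)
    also have "(\<Prod>l\<in>{n..<2 * n}. (Var (W ! l, Suc (q (l - n))) :: (_, 'a) mpoly)) =
        (\<Prod>j<n. Var (drop n W ! j, Suc (q j)))"
      by (rule prod.reindex_bij_witness[of _ "\<lambda>j. j + n" "\<lambda>l. l - n"]) (use assms in auto)
    finally show ?thesis by simp
  qed
  show ?thesis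
    unfolding bracket_det_conv_columns sum_product prod
    by (intro sum.cong refl) (simp add: mult_ac)
qed

text \<open>
The entries of the two rows are listed in \<open>W\<close>, and more than \<open>n\<close> of them are antisymmetrized.  In
each term of the product of the two Leibniz expansions every position carries one of \<open>n\<close>
coordinates, so two of the permuted positions share a coordinate and the term cancels.
\<close>

lemma van_der_Waerden_syzygy:
  assumes "length W = 2 * n" "Z \<subseteq> {..<2 * n}" "n < card Z"
  shows "(\<Sum>\<sigma> | \<sigma> permutes Z. of_int (sign \<sigma>) * (bracket_det n (take n (permute_list \<sigma> W)) *
    bracket_det n (drop n (permute_list \<sigma> W)))) = (0 :: (_, rat) mpoly)"
proof -
  let ?P = "{p. p permutes {..<n}}"
  define \<kappa> where "\<kappa> p q l = (if l < n then p l else q (l - n))" for p q :: "nat \<Rightarrow> nat" and l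
  have vanish: "(\<Sum>\<sigma> | \<sigma> permutes Z. of_int (sign \<sigma>) *
      (\<Prod>l<2 * n. Var (W ! \<sigma> l, Suc (\<kappa> p q l)))) = (0 :: (_, rat) mpoly)"
    if pq: "p \<in> ?P" "q \<in> ?P" for p q
  proof -
    have "\<kappa> p q l < n" if "l < 2 * n" for l
      using pq permutes_in_image[of p "{..<n}" l] permutes_in_image[of q "{..<n}" "l - n"] that
      by (auto simp: \<kappa>_def)
    then have "\<kappa> p q ` Z \<subseteq> {..<n}" using assms(2) by auto
    then have "card (\<kappa> p q ` Z) < card Z"
      using card_mono[of "{..<n}"] assms(3) by (metis card_lessThan finite_lessThan le_less_trans)
    then have "\<not> inj_on (\<kappa> p q) Z" by (rule pigeonhole)
    then obtain a b where "a \<in> Z" "b \<in> Z" "a \<noteq> b" "\<kappa> p q a = \<kappa> p q b"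
      by (auto simp: inj_on_def)
    then show ?thesis
      using alternating_sum_zero[of "{..<2 * n}" Z a b "\<kappa> p q" "\<lambda>v k. Var (W ! v, Suc k)"] assms(2)
      by simp
  qed
  have "(\<Sum>\<sigma> | \<sigma> permutes Z. of_int (sign \<sigma>) * (bracket_det n (take n (permute_list \<sigma> W)) *
      bracket_det n (drop n (permute_list \<sigma> W)))) =
      (\<Sum>\<sigma> | \<sigma> permutes Z. \<Sum>p\<in>?P. \<Sum>q\<in>?P. of_int (sign p * sign q) * (of_int (sign \<sigma>) *
        (\<Prod>l<2 * n. Var (W ! \<sigma> l, Suc (\<kappa> p q l))) :: (_, rat) mpoly))"
  proof (intro sum.cong refl)
    fix \<sigma> assume "\<sigma> \<in> {\<sigma>. \<sigma> permutes Z}"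
    then have "\<sigma> permutes {..<length W}" using assms(1,2) permutes_subset by auto
    then have "permute_list \<sigma> W ! l = W ! \<sigma> l" if "l < 2 * n" for l
      using that assms(1) by (simp add: permute_list_nth)
    then show "of_int (sign \<sigma>) * (bracket_det n (take n (permute_list \<sigma> W)) *
      bracket_det n (drop n (permute_list \<sigma> W))) =
      (\<Sum>p\<in>?P. \<Sum>q\<in>?P. of_int (sign p * sign q) * (of_int (sign \<sigma>) *
        (\<Prod>l<2 * n. Var (W ! \<sigma> l, Suc (\<kappa> p q l))) :: (_, rat) mpoly))"
      using assms(1) by (subst bracket_det_pair) (simp_all add: sum_distrib_left \<kappa>_def mult_ac)
  qed
  also have "\<dots> = (\<Sum>p\<in>?P. \<Sum>q\<in>?P. \<Sum>\<sigma> | \<sigma> permutes Z. of_int (sign p * sign q) * (of_int (sign \<sigma>) *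
        (\<Prod>l<2 * n. Var (W ! \<sigma> l, Suc (\<kappa> p q l))) :: (_, rat) mpoly))"
    by (rule trans[OF sum.swap]) (intro sum.cong refl sum.swap)
  also have "\<dots> = 0"
    using vanish by (simp add: sum_distrib_left[symmetric])
  finally show ?thesis .
qed

text \<open>
A permutation that does not mix the rows splits into one for each row.  Both determinants then
change by signs whose product is the sign of the permutation.
\<close>

lemma stabilizer_term:
  assumes len: "length W = 2 * n" and \<sigma>: "\<sigma> permutes {..<2 * n}" and stab: "\<sigma> ` {..<n} = {..<n}"
  shows "of_int (sign \<sigma>) * (bracket_det n (take n (permute_list \<sigma> W)) *
    bracket_det n (drop n (permute_list \<sigma> W))) =
    (bracket_det n (take n W) * bracket_det n (drop n W) :: (_, 'a::comm_ring_1) mpoly)"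
proof -
  define h1 where "h1 x = (if x < n then \<sigma> x else x)" for x
  define h2 where "h2 x = (if x < n then x else \<sigma> x)" for x
  have inj: "inj \<sigma>" using \<sigma> by (rule permutes_inj)
  have stab2: "\<sigma> ` {n..<2 * n} = {n..<2 * n}"
  proof -
    have "{n..<2 * n} = {..<2 * n} - {..<n}" by auto
    then have "\<sigma> ` {n..<2 * n} = \<sigma> ` {..<2 * n} - \<sigma> ` {..<n}"
      by (simp only: image_set_diff[OF inj])
    also have "\<dots> = {n..<2 * n}" using stab permutes_image[OF \<sigma>] by auto
    finally show ?thesis .
  qed
  have h1: "h1 permutes {..<n}"
  proof (rule bij_imp_permutes)
    have "bij_betw \<sigma> {..<n} {..<n}" using stab inj by (auto simp: bij_betw_def inj_on_def inj_def)
    then show "bij_betw h1 {..<n} {..<n}"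
      by (rule iffD1[OF bij_betw_cong, rotated]) (simp add: h1_def)
  qed (simp add: h1_def)
  have h2: "h2 permutes {n..<2 * n}"
  proof (rule bij_imp_permutes)
    have "bij_betw \<sigma> {n..<2 * n} {n..<2 * n}"
      using stab2 inj by (auto simp: bij_betw_def inj_on_def inj_def)
    then show "bij_betw h2 {n..<2 * n} {n..<2 * n}"
      by (rule iffD1[OF bij_betw_cong, rotated]) (simp add: h2_def)
    show "h2 x = x" if "x \<notin> {n..<2 * n}" for x
      using that \<sigma> by (auto simp: h2_def permutes_def)
  qed
  have \<sigma>_eq: "\<sigma> = h1 \<circ> h2"
  proof
    fix x
    have "n \<le> \<sigma> x" if "n \<le> x"
      using that stab2 \<sigma> by (cases "x < 2 * n") (auto simp: permutes_def)
    then show "\<sigma> x = (h1 \<circ> h2) x" by (auto simp: h1_def h2_def)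
  qed
  define q where "q = map_permutation {n..<2 * n} (\<lambda>l. l - n) h2"
  have inj_shift: "inj_on (\<lambda>l. l - n) {n..<2 * n}" by (auto simp: inj_on_def)
  have "bij_betw (\<lambda>l. l - n) {n..<2 * n} {..<n}"
    by (rule bij_betw_byWitness[where f' = "\<lambda>j. j + n"]) auto
  then have q: "q permutes {..<n}" unfolding q_def using h2 by (rule map_permutation_permutes)
  have sign_q: "sign q = sign h2"
    unfolding q_def using h2 inj_shift by (intro sign_map_permutation) auto
  have q_nth: "q j = \<sigma> (j + n) - n" if "j < n" for j
    using map_permutation_apply[OF inj_shift, of "j + n" h2] that by (simp add: q_def h2_def)
  have take: "take n (permute_list \<sigma> W) = permute_list h1 (take n W)"
  proof (rule nth_equalityI)
    fix i assume "i < length (take n (permute_list \<sigma> W))"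
    then have "i < n" by simp
    moreover from this have "\<sigma> i < n" using stab by auto
    ultimately show "take n (permute_list \<sigma> W) ! i = permute_list h1 (take n W) ! i"
      using \<sigma> h1 len by (simp add: permute_list_nth h1_def)
  qed simp
  have drop: "drop n (permute_list \<sigma> W) = permute_list q (drop n W)"
  proof (rule nth_equalityI)
    fix i assume "i < length (drop n (permute_list \<sigma> W))"
    then have "i < n" using len by simp
    moreover from this have "\<sigma> (i + n) \<in> {n..<2 * n}" using stab2 by auto
    ultimately show "drop n (permute_list \<sigma> W) ! i = permute_list q (drop n W) ! i"
      using \<sigma> q len by (simp add: permute_list_nth q_nth add.commute)
  qed simp
  have perm: "permutation h1" "permutation h2"
    using h1 h2 permutation_permutes by blast+
  have "sign \<sigma> * sign h1 * sign q = 1"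
    using perm by (simp add: \<sigma>_eq sign_compose sign_q mult_ac flip: mult.assoc)
  then have "of_int (sign \<sigma>) * (of_int (sign h1) * x * (of_int (sign q) * y)) = x * y"
    for x y :: "(nat \<times> nat, 'a) mpoly"
    by (metis (no_types, opaque_lifting) mult.assoc mult.left_commute mult_1 of_int_1 of_int_mult)
  then show ?thesis
    unfolding take drop using h1 q len by (simp add: bracket_det_permute)
qed

text \<open>
At a violation \<open>B ! s < A ! s\<close> the exchanged entries are the entries of \<open>A\<close> from position \<open>s\<close> on and
the entries of \<open>B\<close> up to position \<open>s\<close>.  All of the former exceed all of the latter, so
moving some of the latter into the upper row decreases its sum.
\<close>

lemma exchange_decreases_upper_row:
  assumes A: "length A = n" "sorted_wrt (<) A" and B: "length B = n" "sorted_wrt (<) B"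
    and s: "s < n" "B ! s < (A ! s :: nat)"
    and \<sigma>: "\<sigma> permutes {s..n + s}" and moved: "\<sigma> ` {..<n} \<noteq> {..<n}"
  shows "sum_list (take n (permute_list \<sigma> (A @ B))) < sum_list A"
proof -
  define f where "f l = (A @ B) ! l" for l
  define I where "I = \<sigma> ` {..<n}"
  have inj: "inj \<sigma>" using \<sigma> by (rule permutes_inj)
  have finI: "finite I" by (simp add: I_def)
  have cardI: "card I = n" using inj by (simp add: I_def card_image inj_on_subset)
  have "\<sigma> permutes {..<length (A @ B)}"
    using permutes_subset[OF \<sigma>] A B s by (auto simp: subset_iff)
  then have "sum_list (take n (permute_list \<sigma> (A @ B))) = (\<Sum>i<n. f (\<sigma> i))"
    using A B by (simp add: sum_list_sum_nth atLeast0LessThan permute_list_nth f_def)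
  also have "\<dots> = sum f I"
    unfolding I_def using inj by (subst sum.reindex) (auto intro: inj_on_subset)
  also have "\<dots> < sum f {..<n}"
  proof -
    have gained: "f l \<le> B ! s" if l: "l \<in> I - {..<n}" for l
    proof -
      from l obtain i where i: "i < n" "l = \<sigma> i" by (auto simp: I_def)
      with l \<sigma> have "i \<in> {s..n + s}" unfolding permutes_def by (metis DiffD2 lessThan_iff)
      then have "l \<in> {s..n + s}" using permutes_in_image[OF \<sigma>] i by blast
      then have "l - n \<le> s" "n \<le> l" using l by auto
      then show ?thesis
        using sorted_wrt_nth_less[OF B(2), of "l - n" s] A B s
        by (cases "l - n = s") (auto simp: f_def nth_append)
    qed
    have lost: "A ! s \<le> f l" if l: "l \<in> {..<n} - I" for l
    proof -
      have "l \<in> {s..n + s}"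
      proof (rule ccontr)
        assume "l \<notin> {s..n + s}"
        then have "\<sigma> l = l" using \<sigma> by (simp add: permutes_def)
        moreover have "l < n" "l \<notin> I" using l by auto
        ultimately show False unfolding I_def by (metis image_eqI lessThan_iff)
      qed
      then show ?thesis
        using l sorted_wrt_nth_less[OF A(2), of s l] A s
        by (cases "l = s") (auto simp: f_def nth_append)
    qed
    have split: "sum f I = sum f (I \<inter> {..<n}) + sum f (I - {..<n})"
      "sum f {..<n} = sum f (I \<inter> {..<n}) + sum f ({..<n} - I)"
      using sum.Int_Diff[OF finI, of f "{..<n}"] sum.Int_Diff[of "{..<n}" f I]
      by (simp_all only: finite_lessThan Int_commute[of "{..<n}" I])
    have card_eq: "card (I - {..<n}) = card ({..<n} - I)"
      using cardI finI card_Int_Diff[of I "{..<n}"] card_Int_Diff[of "{..<n}" I]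
      by (simp add: Int_commute)
    have "{..<n} - I \<noteq> {}"
    proof
      assume "{..<n} - I = {}"
      then have "{..<n} = I" using cardI finI by (intro card_subset_eq) auto
      then have "\<sigma> ` {..<n} = {..<n}" unfolding I_def by (rule sym)
      with moved show False by contradiction
    qed
    then have pos: "0 < card ({..<n} - I)" by (simp add: card_gt_0_iff)
    have "sum f (I - {..<n}) \<le> card (I - {..<n}) * B ! s"
      using sum_bounded_above[of "I - {..<n}" f "B ! s"] gained by simp
    also have "\<dots> < card ({..<n} - I) * A ! s" using card_eq pos s by simp
    also have "\<dots> \<le> sum f ({..<n} - I)"
      using sum_bounded_below[of "{..<n} - I" "A ! s" f] lost by simp
    finally show ?thesis by (simp add: split)
  qed
  also have "sum f {..<n} = sum_list A"
    using A by (simp add: sum_list_sum_nth atLeast0LessThan f_def nth_append)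
  finally show ?thesis .
qed

text \<open>
Entries count more in higher rows.  The weight ignores the order within a row, and it drops when
an exchange between adjacent rows moves smaller entries upward.
\<close>

fun weight :: "tableau \<Rightarrow> nat" where
  "weight [] = 0"
| "weight (R # Y) = Suc (length Y) * sum_list R + weight Y"

lemma weight_exchange:
  assumes "sum_list A' < sum_list A" "sum_list A' + sum_list B' = sum_list A + sum_list B"
  shows "weight (P @ A' # B' # Q) < weight (P @ A # B # Q)"
proof -
  have top: "weight (A # B # Q) = Suc (length Q) * (sum_list A + sum_list B) + sum_list A + weight Q" for A B
    by (simp add: algebra_simps)
  have "weight (A' # B' # Q) < weight (A # B # Q)"
    unfolding top assms(2) using assms(1) by simp
  then show ?thesis by (induction P) auto
qed

lemma sum_list_sort: "sum_list (sort R) = sum_list R" for R :: "nat list"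
  by (metis mset_sort sum_mset_sum_list)

lemma weight_map_sort: "weight (map sort Y) = weight Y"
  by (induction Y) (auto simp: sum_list_sort)

lemma is_tableau_map_sort: "is_tableau m n d (map sort Y) = is_tableau m n d Y"
  by (simp add: is_tableau_def)

lemma tableau_det_map_sort:
  assumes "\<forall>R \<in> set Y. length R = n"
  shows "\<exists>\<epsilon>. (tableau_det n Y :: (_, 'a::comm_ring_1) mpoly) = of_int \<epsilon> * tableau_det n (map sort Y)"
  using assms
proof (induction Y)
  case Nil
  show ?case by (rule exI[of _ 1]) (simp add: tableau_det_def)
next
  case (Cons R Y)
  then obtain \<epsilon> where \<epsilon>: "(tableau_det n Y :: (_, 'a) mpoly) = of_int \<epsilon> * tableau_det n (map sort Y)"
    by auto
  have "mset R = mset (sort R)" by simp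
  from mset_eq_permutation[OF this] obtain p
    where p: "p permutes {..<n}" "permute_list p (sort R) = R" using Cons.prems by auto
  then have "(bracket_det n R :: (_, 'a) mpoly) = of_int (sign p) * bracket_det n (sort R)"
    using bracket_det_permute[OF p(1), of "sort R", where 'a = 'a] Cons.prems by simp
  with \<epsilon> show ?case
    by (intro exI[of _ "sign p * \<epsilon>"]) (simp add: tableau_det_def mult_ac)
qed

definition straight_span :: "nat \<Rightarrow> nat \<Rightarrow> nat \<Rightarrow> (nat \<times> nat, rat) mpoly set" where
  "straight_span m n d = range (\<lambda>e. \<Sum>S \<in> straight_tableaux m n d. Const (e S) * tableau_det n S)"

lemma Const_add: "Const (a + b) = Const a + (Const b :: (_, 'a::comm_ring_1) mpoly)"
  by (simp add: Const_def single_add)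

lemma Const_mult: "Const (a * b) = Const a * (Const b :: (_, 'a::comm_ring_1) mpoly)"
  by (simp add: Const_def mult_single)

lemma Const_of_nat: "Const (of_nat k) = (of_nat k :: (_, 'a::comm_ring_1) mpoly)"
  by (simp add: Const_def)

lemma Const_neg_inverse:
  assumes "N \<noteq> 0"
  shows "Const (- 1 / of_nat N) * of_nat N = (- 1 :: (_, rat) mpoly)"
proof -
  have "Const (- 1 / of_nat N) * Const (of_nat N) = (Const (- 1) :: (_, rat) mpoly)"
    unfolding Const_mult[symmetric] using assms by simp
  then show ?thesis by (simp add: Const_of_nat) (simp add: Const_def single_uminus)
qed

lemma Const_of_int: "Const (of_int k) = (of_int k :: (_, 'a::comm_ring_1) mpoly)"
  by (simp add: Const_def)

lemma straight_span_add: "p \<in> straight_span m n d \<Longrightarrow> q \<in> straight_span m n d \<Longrightarrow> p + q \<in> straight_span m n d"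
proof -
  assume "p \<in> straight_span m n d" "q \<in> straight_span m n d"
  then obtain e e' where "p = (\<Sum>S \<in> straight_tableaux m n d. Const (e S) * tableau_det n S)"
    "q = (\<Sum>S \<in> straight_tableaux m n d. Const (e' S) * tableau_det n S)"
    by (auto simp: straight_span_def)
  then have "p + q = (\<Sum>S \<in> straight_tableaux m n d. Const (e S + e' S) * tableau_det n S)"
    by (simp add: Const_add sum.distrib distrib_right)
  then show ?thesis by (auto simp: straight_span_def)
qed

lemma straight_span_scale: "p \<in> straight_span m n d \<Longrightarrow> Const c * p \<in> straight_span m n d"
proof -
  assume "p \<in> straight_span m n d"
  then obtain e where "p = (\<Sum>S \<in> straight_tableaux m n d. Const (e S) * tableau_det n S)"
    by (auto simp: straight_span_def)
  then have "Const c * p = (\<Sum>S \<in> straight_tableaux m n d. Const (c * e S) * tableau_det n S)"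
    by (simp add: Const_mult sum_distrib_left mult.assoc)
  then show ?thesis by (auto simp: straight_span_def)
qed

lemma straight_span_0: "0 \<in> straight_span m n d"
  unfolding straight_span_def by (rule range_eqI[of _ _ "\<lambda>_. 0"]) (simp add: Const_def)

lemma straight_span_sum: "(\<And>x. x \<in> A \<Longrightarrow> f x \<in> straight_span m n d) \<Longrightarrow> sum f A \<in> straight_span m n d"
  by (induction A rule: infinite_finite_induct) (auto simp: straight_span_0 straight_span_add)

lemma straight_span_base:
  assumes "S \<in> straight_tableaux m n d"
  shows "tableau_det n S \<in> straight_span m n d"
proof -
  have "(\<Sum>S' \<in> straight_tableaux m n d. Const (if S' = S then 1 else 0) * tableau_det n S') =
      (\<Sum>S' \<in> straight_tableaux m n d. if S' = S then tableau_det n S' else (0 :: (_, rat) mpoly))"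
    by (intro sum.cong) (auto simp: Const_def)
  also have "\<dots> = tableau_det n S" using assms by simp
  finally show ?thesis unfolding straight_span_def by (intro range_eqI[of _ _ "\<lambda>S'. if S' = S then 1 else 0"]) simp
qed

text \<open>
Induction on the weight.  A row with a repeated entry makes the product zero.  After sorting rows, which costs only a sign, a tableau that is not
straight has an entry larger than the one below it.  In the syzygy for these two rows the
permutations preserving the rows contribute a positive multiple of the given product, and all
others contribute tableaux of smaller weight.
\<close>

theorem tableau_det_in_straight_span:
  assumes "is_tableau m n d Y" "1 \<le> d"
  shows "tableau_det n Y \<in> straight_span m n d"
  using assms(1)
proof (induction "weight Y" arbitrary: Y rule: less_induct)
  case less
  note Y = less.prems
  show ?case
  proof (cases "\<forall>R \<in> set Y. distinct R")
    case False
    then obtain R where R: "R \<in> set Y" "\<not> distinct R" by auto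
    then have "bracket_det n R = (0 :: (_, rat) mpoly)"
      using Y by (intro bracket_det_repeated) (auto simp: is_tableau_def)
    then have "tableau_det n Y = (0 :: (_, rat) mpoly)"
      using split_list[OF R(1)] by (auto simp: tableau_det_def)
    then show ?thesis by (simp add: straight_span_0)
  next
    case True
    define Z where "Z = map sort Y"
    have Z: "is_tableau m n d Z" "weight Z = weight Y"
      using Y by (simp_all add: Z_def is_tableau_map_sort weight_map_sort)
    have strict: "\<forall>R \<in> set Z. sorted_wrt (<) R"
      using True by (auto simp: Z_def strict_sorted_iff)
    obtain \<epsilon> where \<epsilon>: "(tableau_det n Y :: (_, rat) mpoly) = of_int \<epsilon> * tableau_det n Z"
      using tableau_det_map_sort[of Y n, where 'a = rat] Y by (auto simp: Z_def is_tableau_def)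
    have "tableau_det n Z \<in> straight_span m n d"
    proof (cases "straight Z")
      case True
      then show ?thesis using Z(1) by (intro straight_span_base) (simp add: straight_tableaux_def)
    next
      case False
      then obtain s where s: "s < n" "\<not> sorted (column s Z)"
        using straight_tableau_iff[OF Z(1) assms(2)] strict by auto
      have len: "length Z = d" using Z(1) by (rule is_tableau_length)
      from s(2) obtain i where i: "Suc i < d" "Z ! Suc i ! s < Z ! i ! s"
        by (auto simp: sorted_iff_nth_Suc len not_le)
      define P A B Q where "P = take i Z" and "A = Z ! i" and "B = Z ! Suc i" and "Q = drop (Suc (Suc i)) Z"
      have Z_eq: "Z = P @ A # B # Q"
        using i(1) len unfolding P_def A_def B_def Q_def
        by (metis Cons_nth_drop_Suc Suc_lessD append_take_drop_id)
      have AB: "length A = n" "length B = n" "sorted_wrt (<) A" "sorted_wrt (<) B" "B ! s < A ! s"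
        using Z(1) i strict len by (auto simp: A_def B_def is_tableau_row)
      \<comment> \<open>Positions \<open>s..n + s\<close> of \<open>A @ B\<close> hold the last \<open>n - s\<close> entries of \<open>A\<close> and the first \<open>s + 1\<close> of \<open>B\<close>.\<close>
      let ?G = "{\<sigma>. \<sigma> permutes {s..n + s}}"
      let ?H = "{\<sigma> \<in> ?G. \<sigma> ` {..<n} = {..<n}}"
      define Z' where "Z' \<sigma> = P @ take n (permute_list \<sigma> (A @ B)) # drop n (permute_list \<sigma> (A @ B)) # Q" for \<sigma>
      have perm: "\<sigma> permutes {..<2 * n}" if "\<sigma> \<in> ?G" for \<sigma>
        using that s(1) by (auto intro: permutes_subset)
      have expand: "tableau_det n (Z' \<sigma>) = tableau_det n P * tableau_det n Q *
          (bracket_det n (take n (permute_list \<sigma> (A @ B))) *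
           bracket_det n (drop n (permute_list \<sigma> (A @ B))) :: (_, rat) mpoly)" for \<sigma>
        by (simp add: Z'_def tableau_det_def mult_ac)
      have expand_Z: "tableau_det n Z = tableau_det n P * tableau_det n Q *
          (bracket_det n (take n (A @ B)) * bracket_det n (drop n (A @ B)) :: (_, rat) mpoly)"
        using AB by (simp add: Z_eq tableau_det_def mult_ac)
      have "(\<Sum>\<sigma>\<in>?G. of_int (sign \<sigma>) * tableau_det n (Z' \<sigma>)) =
          tableau_det n P * tableau_det n Q * (\<Sum>\<sigma>\<in>?G. of_int (sign \<sigma>) *
          (bracket_det n (take n (permute_list \<sigma> (A @ B))) *
           bracket_det n (drop n (permute_list \<sigma> (A @ B)))) :: (_, rat) mpoly)"
        by (simp add: expand sum_distrib_left mult_ac)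
      also have "\<dots> = 0"
        using AB s(1) by (subst van_der_Waerden_syzygy) auto
      finally have syzygy: "(\<Sum>\<sigma>\<in>?G. of_int (sign \<sigma>) * tableau_det n (Z' \<sigma>)) = (0 :: (_, rat) mpoly)" .
      have "of_int (sign \<sigma>) * tableau_det n (Z' \<sigma>) = (tableau_det n Z :: (_, rat) mpoly)" if "\<sigma> \<in> ?H" for \<sigma>
        using stabilizer_term[of "A @ B" n \<sigma>, where 'a = rat] that AB perm[of \<sigma>]
        by (simp add: expand expand_Z mult.left_commute[of "of_int (sign \<sigma>)"])
      then have "(\<Sum>\<sigma>\<in>?H. of_int (sign \<sigma>) * tableau_det n (Z' \<sigma>)) =
          (of_nat (card ?H) * tableau_det n Z :: (_, rat) mpoly)" by simp
      moreover have "(\<Sum>\<sigma>\<in>?G. of_int (sign \<sigma>) * tableau_det n (Z' \<sigma>)) =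
          (\<Sum>\<sigma>\<in>?G - ?H. of_int (sign \<sigma>) * tableau_det n (Z' \<sigma>)) +
          (\<Sum>\<sigma>\<in>?H. of_int (sign \<sigma>) * tableau_det n (Z' \<sigma>) :: (_, rat) mpoly)"
        by (rule sum.subset_diff) (auto intro: finite_permutations)
      ultimately have rel: "of_nat (card ?H) * tableau_det n Z =
          - (\<Sum>\<sigma>\<in>?G - ?H. of_int (sign \<sigma>) * tableau_det n (Z' \<sigma>) :: (_, rat) mpoly)"
        using syzygy by (simp add: eq_neg_iff_add_eq_0 add.commute)
      have "id \<in> ?H" by (simp add: permutes_id)
      moreover have "finite ?H" using finite_permutations[of "{s..n + s}"] by simp
      ultimately have "card ?H \<noteq> 0" by (metis card_eq_0_iff empty_iff)
      then have "Const (- 1 / of_nat (card ?H)) * of_nat (card ?H) = (- 1 :: (nat \<times> nat, rat) mpoly)"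
        by (rule Const_neg_inverse)
      then have "tableau_det n Z = Const (- 1 / of_nat (card ?H)) *
          (- (of_nat (card ?H) * tableau_det n Z) :: (_, rat) mpoly)"
        by (simp add: mult.assoc[symmetric])
      also have "\<dots> = Const (- 1 / of_nat (card ?H)) *
          (\<Sum>\<sigma>\<in>?G - ?H. Const (of_int (sign \<sigma>)) * tableau_det n (Z' \<sigma>))"
        unfolding rel by (simp only: minus_minus Const_of_int)
      also have "\<dots> \<in> straight_span m n d"
      proof (intro straight_span_scale straight_span_sum)
        fix \<sigma> assume \<sigma>: "\<sigma> \<in> ?G - ?H"
        let ?A = "take n (permute_list \<sigma> (A @ B))" and ?B = "drop n (permute_list \<sigma> (A @ B))"
        have mset: "mset (?A @ ?B) = mset (A @ B)"
          using perm[of \<sigma>] \<sigma> AB by (simp add: mult_2 del: mset_append)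
        then have "sum_list ?A + sum_list ?B = sum_list A + sum_list B"
          by (metis sum_mset_sum_list sum_list_append)
        moreover have "sum_list ?A < sum_list A"
          using \<sigma> AB s(1) by (intro exchange_decreases_upper_row) auto
        ultimately have "weight (Z' \<sigma>) < weight Z"
          unfolding Z'_def Z_eq by (intro weight_exchange)
        moreover have "is_tableau m n d (Z' \<sigma>)"
        proof -
          have "set ?A \<union> set ?B = set A \<union> set B"
            using mset by (metis mset_eq_setD set_append)
          then show ?thesis
            using Z(1) AB unfolding Z_eq Z'_def is_tableau_def by auto
        qed
        ultimately show "tableau_det n (Z' \<sigma>) \<in> straight_span m n d"
          using less.hyps Z(2) by simp
      qed
      finally show ?thesis .
    qed
    then show ?thesis
      unfolding \<epsilon> Const_of_int[symmetric] by (rule straight_span_scale)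
  qed
qed

section \<open>Integral straightening\<close>

lemma lookup_Const_mult:
  "Poly_Mapping.lookup (Const c * p) \<mu> = c * Poly_Mapping.lookup p \<mu>"
  for p :: "('v, 'a::comm_ring_1) mpoly"
  unfolding Const_def mult_map_scale_conv_mult[symmetric]
  by (simp add: Poly_Mapping.map.rep_eq when_def)

text \<open>
Existence of rational coefficients comes from the straightening law.  The algorithm, run over the
integers on \<open>Y\<close> alone, gives integers that satisfy the same equations at all contents of straight
tableaux; these equations have only one solution over the rationals.
\<close>

lemma integral_straightening:
  assumes Y: "is_tableau m n d Y" and "1 \<le> d" "1 \<le> n"
  shows "\<exists>e. \<forall>\<mu>. det_coeff n \<mu> Y = (\<Sum>S \<in> straight_tableaux m n d. e S * det_coeff n \<mu> S)"
proof -
  let ?St = "straight_tableaux m n d"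
  have St: "is_tableau m n d S \<and> straight S" if "S \<in> ?St" for S
    using that by (simp add: straight_tableaux_def)
  obtain e' where e': "(tableau_det n Y :: (_, rat) mpoly) = (\<Sum>S \<in> ?St. Const (e' S) * tableau_det n S)"
    using tableau_det_in_straight_span[OF Y assms(2)] by (auto simp: straight_span_def)
  have rat: "(of_int (det_coeff n \<mu> Y) :: rat) = (\<Sum>S \<in> ?St. e' S * of_int (det_coeff n \<mu> S))" for \<mu>
  proof -
    have "(of_int (det_coeff n \<mu> Y) :: rat) = Poly_Mapping.lookup (tableau_det n Y) \<mu>"
      using lookup_tableau_det[OF Y, where 'a = rat] by simp
    also have "\<dots> = (\<Sum>S \<in> ?St. e' S * Poly_Mapping.lookup (tableau_det n S) \<mu>)"
      unfolding e' by (simp add: lookup_sum lookup_Const_mult)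
    also have "\<dots> = (\<Sum>S \<in> ?St. e' S * of_int (det_coeff n \<mu> S))"
      using St lookup_tableau_det[where 'a = rat] by (intro sum.cong refl) metis
    finally show ?thesis .
  qed
  obtain g :: "tableau \<Rightarrow>\<^sub>0 int" where g: "Poly_Mapping.keys g \<subseteq> ?St"
    "\<And>N. N \<in> ?St \<Longrightarrow> det_expansion n g (content_monomial n N) = det_coeff n (content_monomial n N) Y"
    using straightening_algorithm_terminates[where \<alpha> = "\<lambda>_. 1 :: int" and M = 1 and X = "\<lambda>_. Y", OF assms(2,3,1)]
    by auto
  have "of_int (Poly_Mapping.lookup g S) - e' S = 0" if "S \<in> ?St" for S
  proof (rule straight_combination_zero[OF finite_straight_tableaux _ \<open>1 \<le> n\<close> _ that])
    fix N assume N: "N \<in> ?St"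
    have "(\<Sum>S\<in>?St. (of_int (Poly_Mapping.lookup g S) - e' S) * of_int (det_coeff n (content_monomial n N) S)) =
        of_int (det_expansion n g (content_monomial n N)) - of_int (det_coeff n (content_monomial n N) Y)"
      unfolding rat det_expansion_superset[OF finite_straight_tableaux g(1)]
      by (simp add: left_diff_distrib sum_subtractf)
    then show "(\<Sum>S\<in>?St. (of_int (Poly_Mapping.lookup g S) - e' S) *
        of_int (det_coeff n (content_monomial n N) S)) = 0"
      using g(2)[OF N] by simp
  next
    show "is_tableau m n (length S) S \<and> straight S" if "S \<in> ?St" for S
      using St[OF that] by (auto simp: is_tableau_length)
  qed
  then have e'_eq: "e' S = of_int (Poly_Mapping.lookup g S)" if "S \<in> ?St" for S
    using that by simp
  have "(of_int (det_coeff n \<mu> Y) :: rat) =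
      of_int (\<Sum>S \<in> ?St. Poly_Mapping.lookup g S * det_coeff n \<mu> S)" for \<mu>
    unfolding rat by (simp add: e'_eq)
  then have "det_coeff n \<mu> Y = (\<Sum>S \<in> ?St. Poly_Mapping.lookup g S * det_coeff n \<mu> S)" for \<mu>
    by (simp only: of_int_eq_iff)
  then show ?thesis by blast
qed

section \<open>Bracket polynomials and the straight expression\<close>

definition row_exponent :: "tableau \<Rightarrow> (nat list \<Rightarrow>\<^sub>0 nat)" where
  "row_exponent Y = (\<Sum>R\<leftarrow>Y. Poly_Mapping.single R 1)"

lemma lookup_row_exponent: "Poly_Mapping.lookup (row_exponent Y) R = count_list Y R"
  by (induction Y) (auto simp: row_exponent_def lookup_add lookup_single)

lemma bracket_monomial_single:
  "Const c * bracket_monomial Y = Poly_Mapping.single (row_exponent Y) (c :: 'a::comm_ring_1)"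
proof -
  have "bracket_monomial Y = Poly_Mapping.single (row_exponent Y) (1 :: 'a)"
    by (induction Y) (auto simp: bracket_monomial_def row_exponent_def Var_def mult_single)
  then show ?thesis by (simp add: Const_def mult_single)
qed

lemma prod_power_count_list:
  fixes f :: "'b \<Rightarrow> 'c::comm_monoid_mult"
  assumes "finite A" "set xs \<subseteq> A"
  shows "(\<Prod>x\<in>A. f x ^ count_list xs x) = (\<Prod>x\<leftarrow>xs. f x)"
  using assms(2)
proof (induction xs)
  case (Cons y xs)
  have "(\<Prod>x\<in>A. f x ^ count_list (y # xs) x) =
      (\<Prod>x\<in>A. (if x = y then f x else 1) * f x ^ count_list xs x)"
    by (intro prod.cong) auto
  also have "\<dots> = f y * (\<Prod>x\<in>A. f x ^ count_list xs x)"
    using Cons.prems assms(1) by (simp add: prod.distrib)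
  finally show ?case using Cons by simp
qed simp

lemma substitute_dets_superset:
  assumes "finite A" "Poly_Mapping.keys p \<subseteq> A"
  shows "substitute_dets n p = (\<Sum>\<mu>\<in>A. Const (Poly_Mapping.lookup p \<mu>) *
    (\<Prod>R \<in> Poly_Mapping.keys \<mu>. bracket_det n R ^ Poly_Mapping.lookup \<mu> R))"
  unfolding substitute_dets_def
  using assms by (intro sum.mono_neutral_left) (auto simp: in_keys_iff Const_def)

lemma substitute_dets_add: "substitute_dets n (p + q) = substitute_dets n p + substitute_dets n q"
proof -
  let ?A = "Poly_Mapping.keys p \<union> Poly_Mapping.keys q"
  have "Poly_Mapping.keys (p + q) \<subseteq> ?A" by (rule keys_add)
  then show ?thesis
    by (simp add: substitute_dets_superset[of ?A] lookup_add Const_add distrib_right sum.distrib)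
qed

lemma substitute_dets_0: "substitute_dets n 0 = 0"
  by (simp add: substitute_dets_def)

lemma substitute_dets_diff: "substitute_dets n (p - q) = substitute_dets n p - substitute_dets n q"
  using substitute_dets_add[of n "p - q" q] by (simp add: algebra_simps)

lemma substitute_dets_sum: "substitute_dets n (\<Sum>x\<in>A. f x) = (\<Sum>x\<in>A. substitute_dets n (f x))"
  by (induction A rule: infinite_finite_induct) (auto simp: substitute_dets_0 substitute_dets_add)

lemma substitute_dets_monomial:
  "substitute_dets n (Const c * bracket_monomial Y) = Const (c :: 'a::comm_ring_1) * tableau_det n Y"
proof -
  let ?\<mu> = "row_exponent Y"
  have "Poly_Mapping.keys ?\<mu> = set Y"
    by (auto simp: in_keys_iff lookup_row_exponent count_list_0_iff)
  then have "(\<Prod>R \<in> Poly_Mapping.keys ?\<mu>. bracket_det n R ^ Poly_Mapping.lookup ?\<mu> R) =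
      (tableau_det n Y :: (_, 'a) mpoly)"
    by (simp add: lookup_row_exponent prod_power_count_list tableau_det_def)
  then show ?thesis
    unfolding bracket_monomial_single by (subst substitute_dets_superset[of "{?\<mu>}"]) auto
qed

lemma lookup_substitute_combination:
  assumes "\<And>x. x \<in> A \<Longrightarrow> is_tableau m n (length (Y x)) (Y x)"
  shows "Poly_Mapping.lookup (substitute_dets n (\<Sum>x\<in>A. Const (c x) * bracket_monomial (Y x))) \<mu> =
    (\<Sum>x\<in>A. c x * of_int (det_coeff n \<mu> (Y x)))"
  by (simp add: substitute_dets_sum substitute_dets_monomial lookup_sum lookup_Const_mult
      lookup_tableau_det[OF assms])

lemma combination_in_bracket_polys:
  assumes "\<And>x. x \<in> A \<Longrightarrow> is_tableau m n (length (Y x)) (Y x)"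
  shows "(\<Sum>x\<in>A. Const (c x) * bracket_monomial (Y x)) \<in> bracket_polys m n"
proof -
  have "Poly_Mapping.keys \<mu> \<subseteq> brackets m n"
    if \<mu>: "\<mu> \<in> Poly_Mapping.keys (\<Sum>x\<in>A. Const (c x) * bracket_monomial (Y x))" for \<mu>
  proof -
    obtain x where x: "x \<in> A" "\<mu> \<in> Poly_Mapping.keys (Const (c x) * bracket_monomial (Y x))"
      using subsetD[OF keys_sum \<mu>] by auto
    then have "\<mu> = row_exponent (Y x)"
      unfolding bracket_monomial_single by (auto split: if_splits)
    then have "Poly_Mapping.keys \<mu> \<subseteq> set (Y x)"
      by (auto simp: in_keys_iff lookup_row_exponent count_list_0_iff)
    also have "\<dots> \<subseteq> brackets m n"
      using assms[OF x(1)] by (auto simp: is_tableau_def brackets_def)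
    finally show ?thesis .
  qed
  then show ?thesis by (simp add: bracket_polys_def)
qed

lemma bracket_polys_diff: "p \<in> bracket_polys m n \<Longrightarrow> q \<in> bracket_polys m n \<Longrightarrow> p - q \<in> bracket_polys m n"
  for p :: "(nat list, 'a::comm_ring_1) mpoly"
  unfolding bracket_polys_def using keys_diff[of p q] by blast

theorem proposition3:
  fixes \<alpha> :: "nat \<Rightarrow> 'a::field" and X :: "nat \<Rightarrow> tableau" and m n d M :: nat
    and F :: "(nat list, 'a) mpoly"
  assumes "CHAR('a) \<noteq> 2"
    and "1 \<le> n" and "n \<le> m" and "1 \<le> d"
    and "\<And>i. i \<in> {1..M} \<Longrightarrow> is_tableau m n d (X i)"
    and "F = (\<Sum>i = 1..M. Const (\<alpha> i) * bracket_monomial (X i))"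
  shows "\<exists>g. straightening_algorithm n M \<alpha> X = Some g \<and>
    is_straight_expression m n F g \<and>
    (\<forall>h. is_straight_expression m n F h \<longrightarrow> h = g)"
proof -
  let ?St = "straight_tableaux m n d"
  have X: "is_tableau m n (length (X i)) (X i)" if "i \<in> {1..M}" for i
    using assms(5)[OF that] by (simp add: is_tableau_length)
  have F_polys: "F \<in> bracket_polys m n"
    unfolding assms(6) using X by (rule combination_in_bracket_polys)
  have F_lookup: "Poly_Mapping.lookup (substitute_dets n F) \<mu> =
      (\<Sum>i = 1..M. \<alpha> i * of_int (det_coeff n \<mu> (X i)))" for \<mu>
    unfolding assms(6) using X by (rule lookup_substitute_combination)
  have poly_lookup: "Poly_Mapping.lookup (substitute_dets n (bracket_poly_of h)) \<mu> = det_expansion n h \<mu>"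
    if "\<forall>Y \<in> Poly_Mapping.keys h. is_tableau m n (length Y) Y" for h :: "tableau \<Rightarrow>\<^sub>0 'a" and \<mu>
    unfolding bracket_poly_of_def det_expansion_def
    using that by (intro lookup_substitute_combination) blast
  obtain g where g: "straightening_algorithm n M \<alpha> X = Some g" "Poly_Mapping.keys g \<subseteq> ?St"
    "\<And>N. N \<in> ?St \<Longrightarrow> det_expansion n g (content_monomial n N) =
      (\<Sum>i = 1..M. \<alpha> i * of_int (det_coeff n (content_monomial n N) (X i)))"
    using straightening_algorithm_terminates[where \<alpha> = \<alpha> and X = X and M = M, OF assms(4,2,5)] by blast
  have g_tableau: "is_tableau m n (length Y) Y \<and> straight Y" if "Y \<in> ?St" for Y
    using that by (auto simp: straight_tableaux_def is_tableau_length)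
  from integral_straightening[OF assms(5,4,2)] obtain e where e:
    "\<And>i \<mu>. i \<in> {1..M} \<Longrightarrow> det_coeff n \<mu> (X i) = (\<Sum>S \<in> ?St. e i S * det_coeff n \<mu> S)"
    by metis
  \<comment> \<open>The coefficients of the straight expression of \<open>F\<close> obtained from the integral ones by linearity.\<close>
  define f where "f S = (\<Sum>i = 1..M. \<alpha> i * of_int (e i S))" for S
  have F_expand: "(\<Sum>i = 1..M. \<alpha> i * of_int (det_coeff n \<mu> (X i))) =
      (\<Sum>S \<in> ?St. f S * of_int (det_coeff n \<mu> S))" for \<mu>
  proof -
    have "(\<Sum>i = 1..M. \<alpha> i * of_int (det_coeff n \<mu> (X i))) =
        (\<Sum>i = 1..M. \<Sum>S \<in> ?St. \<alpha> i * of_int (e i S) * of_int (det_coeff n \<mu> S))"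
      using e by (simp add: sum_distrib_left mult.assoc)
    also have "\<dots> = (\<Sum>S \<in> ?St. f S * of_int (det_coeff n \<mu> S))"
      by (subst sum.swap) (simp add: f_def sum_distrib_right)
    finally show ?thesis .
  qed
  have "Poly_Mapping.lookup g S - f S = 0" if "S \<in> ?St" for S
  proof (rule straight_combination_zero[OF finite_straight_tableaux g_tableau assms(2) _ that])
    fix N assume "N \<in> ?St"
    then show "(\<Sum>S \<in> ?St. (Poly_Mapping.lookup g S - f S) * of_int (det_coeff n (content_monomial n N) S)) = 0"
      using g(3) F_expand[of "content_monomial n N"]
      by (simp add: left_diff_distrib sum_subtractf det_expansion_superset[OF finite_straight_tableaux g(2)])
  qed
  then have g_expand: "det_expansion n g \<mu> = Poly_Mapping.lookup (substitute_dets n F) \<mu>" for \<mu>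
    unfolding F_lookup F_expand det_expansion_superset[OF finite_straight_tableaux g(2)] by simp
  have g_keys: "\<forall>Y \<in> Poly_Mapping.keys g. is_tableau m n (length Y) Y \<and> straight Y"
    using g(2) g_tableau by blast
  then have "substitute_dets n (bracket_poly_of g) = substitute_dets n F"
    by (intro poly_mapping_eqI) (simp add: poly_lookup g_expand)
  moreover have "bracket_poly_of g - F \<in> bracket_polys m n"
    unfolding bracket_poly_of_def using F_polys g_keys
    by (intro bracket_polys_diff combination_in_bracket_polys) auto
  ultimately have g_expr: "is_straight_expression m n F g"
    using g_keys by (simp add: is_straight_expression_def equal_in_bracket_algebra_def
        syzygy_ideal_def substitute_dets_diff)
  have "h = g" if h: "is_straight_expression m n F h" for h
  proof (rule poly_mapping_eqI)
    let ?T = "Poly_Mapping.keys g \<union> Poly_Mapping.keys h"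
    have h_keys: "\<forall>Y \<in> Poly_Mapping.keys h. is_tableau m n (length Y) Y \<and> straight Y"
      and h_sub: "substitute_dets n (bracket_poly_of h) = substitute_dets n F"
      using h by (auto simp: is_straight_expression_def equal_in_bracket_algebra_def
          syzygy_ideal_def substitute_dets_diff)
    have same: "det_expansion n h \<mu> = det_expansion n g \<mu>" for \<mu>
      using poly_lookup[of h \<mu>] h_keys by (simp add: h_sub g_expand)
    fix Y
    have "Poly_Mapping.lookup h Y - Poly_Mapping.lookup g Y = 0" if "Y \<in> ?T"
    proof (rule straight_combination_zero[OF _ _ assms(2) _ that])
      fix S
      show "(\<Sum>Y \<in> ?T. (Poly_Mapping.lookup h Y - Poly_Mapping.lookup g Y) *
          of_int (det_coeff n (content_monomial n S) Y)) = 0"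
        using same[of "content_monomial n S"]
        by (simp add: left_diff_distrib sum_subtractf det_expansion_superset[of ?T])
    qed (use g_keys h_keys in auto)
    then show "Poly_Mapping.lookup h Y = Poly_Mapping.lookup g Y"
      by (cases "Y \<in> ?T") (auto simp: in_keys_iff)
  qed
  with g(1) g_expr show ?thesis by blast
qed

end
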